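(* Let $k$ be an algebraically closed field of characteristic zero and let $\mathcal{Q}uad=\mathcal{D}end\,\blacksquare\,\mathcal{D}end$ over $k$ (as a non-symmetric operad). For every $n\ge1$, the dimension of $\mathcal{Q}uad(n)$ is $$d_n=\frac1n\sum_{j=n}^{2n-1}\binom{3n}{n+1+j}\binom{j-1}{j-n}.$$
   Context: Conventions. All operads come from non-symmetric operads over an algebraically closed field $k$ of characteristic zero, and $\mathcal{Q}uad(n)$ denotes the arity $n$ component of the non-symmetric operad (the symmetric operad is recovered by tensoring with $k[\Sigma_n]$). For a finite-dimensional vector space $\Omega$ and a subspace $\Lambda\subset\Omega^{\otimes 2}\oplus\Omega^{\otimes 2}$, $\mathcal{P}(\Omega,\Lambda)$ denotes the quadratic operad generated by the binary operations $\Omega$ subject to the relations $\Lambda$: an element $(u,v)\in\Lambda$ stands for the relation $u=v$, where $\circ_1\otimes\circ_2$ in the first summand stands for $(x\circ_1 y)\circ_2 z$ and $\circ_3\otimes\circ_4$ in the second summand stands for $x\circ_3(y\circ_4 z)$. The operad $\mathcal{D}end$ (dendriform algebras) is generated by two binary operations $\prec,\succ$ with the three relations, where $*=\prec+\succ$: $(x\prec y)\prec z=x\prec(y*z)$, $(x\succ y)\prec z=x\succ(y\prec z)$, $(x*y)\succ z=x\succ(y\succ z)$. Black square product: $\mathcal{P}(\Omega_1,\Lambda_1)\,\blacksquare\,\mathcal{P}(\Omega_2,\Lambda_2)=\mathcal{P}(\Omega_1\otimes\Omega_2,\,S_{23}(\Lambda_1\otimes\Lambda_2))$, where $S_{23}(\Lambda_1\otimes\Lambda_2)$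 is the span of the elements $(S_{23}(u\otimes u'),S_{23}(v\otimes v'))$ for $(u,v)\in\Lambda_1$, $(u',v')\in\Lambda_2$, and $S_{23}:\Omega_1^{\otimes2}\otimes\Omega_2^{\otimes2}\to(\Omega_1\otimes\Omega_2)^{\otimes2}$ switches the second and third tensor factors. Thus $\mathcal{Q}uad$ has four generating operations (pairs of operations of $\mathcal{D}end$) and nine relations (pairs of relations of $\mathcal{D}end$). *)

theory Defs
  imports
    "Jordan_Normal_Form.VS_Connect"
    "HOL-Algebra.AbelCoset"
    "HOL-Library.Poly_Mapping"
    "HOL-Library.Tree"
begin

section \<open>Vector spaces with a distinguished basis\<close>

text \<open>The vector space with basis \<^term>\<open>X\<close>: finitely supported families of scalars. The record
  fields \<^term>\<open>mult\<close> and \<^term>\<open>one\<close> play no role in a module.\<close>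

definition free_vs :: "'x set \<Rightarrow> ('k::field, 'x \<Rightarrow>\<^sub>0 'k) module" where
  "free_vs X =
    \<lparr>carrier = {p. Poly_Mapping.keys p \<subseteq> X}, mult = (\<lambda>_ _. 0), one = 0, zero = 0, add = (+),
     smult = (\<lambda>c. Poly_Mapping.map ((*) c))\<rparr>"

definition lin_ext :: "('x \<Rightarrow> 'y) \<Rightarrow> ('x \<Rightarrow>\<^sub>0 'k::field) \<Rightarrow> ('y \<Rightarrow>\<^sub>0 'k)" where
  "lin_ext f p =
    (\<Sum>x\<in>Poly_Mapping.keys p. Poly_Mapping.single (f x) (Poly_Mapping.lookup p x))"

text \<open>The tensor product of the spaces with bases \<open>'x\<close> and \<open>'y\<close> is the space with basis
  \<open>'x \<times> 'y\<close>, the pair \<open>(x, y)\<close> being the basis vector \<open>x \<otimes> y\<close>.\<close>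

definition tensor :: "('x \<Rightarrow>\<^sub>0 'k::field) \<Rightarrow> ('y \<Rightarrow>\<^sub>0 'k) \<Rightarrow> ('x \<times> 'y \<Rightarrow>\<^sub>0 'k)" where
  "tensor p q =
    (\<Sum>x\<in>Poly_Mapping.keys p. \<Sum>y\<in>Poly_Mapping.keys q.
      Poly_Mapping.single (x, y) (Poly_Mapping.lookup p x * Poly_Mapping.lookup q y))"

definition quotient_module ::
    "('k, 'v) module \<Rightarrow> 'v set \<Rightarrow> ('k, 'v set) module" where
  "quotient_module M N =
    \<lparr>carrier = a_rcosets\<^bsub>M\<^esub> N, mult = (\<lambda>_ _. N), one = N, zero = N, add = set_add M,
     smult = (\<lambda>c A. \<Union>x\<in>A. N +>\<^bsub>M\<^esub> (c \<odot>\<^bsub>M\<^esub> x))\<rparr>"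


section \<open>Non-symmetric operads, ideals and quotients\<close>

text \<open>\<open>partial_comp P m n i x y\<close> is the partial composition \<open>x \<circ>\<^sub>i y\<close> of \<open>x \<in> P(m)\<close> and \<open>y \<in> P(n)\<close>,
  meaningful for \<open>1 \<le> i \<le> m\<close>; it lies in \<open>P(m + n - 1)\<close>.\<close>

record ('k, 'v) ns_operad =
  component :: "nat \<Rightarrow> ('k, 'v) module"
  partial_comp :: "nat \<Rightarrow> nat \<Rightarrow> nat \<Rightarrow> 'v \<Rightarrow> 'v \<Rightarrow> 'v"
  op_unit :: 'v

inductive in_generated_ideal ::
    "('k, 'v) ns_operad \<Rightarrow> (nat \<Rightarrow> 'v set) \<Rightarrow> nat \<Rightarrow> 'v \<Rightarrow> bool"
  for P :: "('k, 'v) ns_operad" and R :: "nat \<Rightarrow> 'v set" where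
  gen: "r \<in> R n \<Longrightarrow> in_generated_ideal P R n r"
| zero: "in_generated_ideal P R n \<zero>\<^bsub>component P n\<^esub>"
| add: "in_generated_ideal P R n x \<Longrightarrow> in_generated_ideal P R n y \<Longrightarrow>
    in_generated_ideal P R n (x \<oplus>\<^bsub>component P n\<^esub> y)"
| smult: "in_generated_ideal P R n x \<Longrightarrow> in_generated_ideal P R n (c \<odot>\<^bsub>component P n\<^esub> x)"
| compose_left: "in_generated_ideal P R m x \<Longrightarrow> y \<in> carrier (component P n) \<Longrightarrow>
    1 \<le> i \<Longrightarrow> i \<le> m \<Longrightarrow> in_generated_ideal P R (m + n - 1) (partial_comp P m n i x y)"
| compose_right: "x \<in> carrier (component P m) \<Longrightarrow> in_generated_ideal P R n y \<Longrightarrow>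
    1 \<le> i \<Longrightarrow> i \<le> m \<Longrightarrow> in_generated_ideal P R (m + n - 1) (partial_comp P m n i x y)"

definition generated_ideal ::
    "('k, 'v) ns_operad \<Rightarrow> (nat \<Rightarrow> 'v set) \<Rightarrow> nat \<Rightarrow> 'v set" where
  "generated_ideal P R n = {x. in_generated_ideal P R n x}"

definition quotient_operad ::
    "('k, 'v) ns_operad \<Rightarrow> (nat \<Rightarrow> 'v set) \<Rightarrow> ('k, 'v set) ns_operad" where
  "quotient_operad P J =
    \<lparr>component = (\<lambda>n. quotient_module (component P n) (J n)),
     partial_comp = (\<lambda>m n i A B. \<Union>x\<in>A. \<Union>y\<in>B.
       J (m + n - 1) +>\<^bsub>component P (m + n - 1)\<^esub> partial_comp P m n i x y),
     op_unit = J 1 +>\<^bsub>component P 1\<^esub> op_unit P\<rparr>"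


section \<open>The free operad on binary operations\<close>

text \<open>A monomial of arity \<open>n\<close> in the binary operations \<open>'b\<close> is a planar binary tree with \<open>n\<close> leaves
  (the inputs, read from left to right) and inner nodes labelled by operations, the root being the
  operation applied last. Inputs are numbered from 1, and \<open>graft t i s\<close> substitutes \<open>s\<close> for the
  \<open>i\<close>-th input of \<open>t\<close>.\<close>

fun graft :: "'b tree \<Rightarrow> nat \<Rightarrow> 'b tree \<Rightarrow> 'b tree" where
  "graft \<langle>\<rangle> i s = s"
| "graft \<langle>l, a, r\<rangle> i s =
    (if i \<le> size1 l then \<langle>graft l i s, a, r\<rangle> else \<langle>l, a, graft r (i - size1 l) s\<rangle>)"

definition free_operad :: "('k::field, 'b tree \<Rightarrow>\<^sub>0 'k) ns_operad" where
  "free_operad =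
    \<lparr>component = (\<lambda>n. free_vs {t. size1 t = n}),
     partial_comp = (\<lambda>m n i p q. lin_ext (\<lambda>(t, s). graft t i s) (tensor p q)),
     op_unit = Poly_Mapping.single \<langle>\<rangle> 1\<rparr>"


section \<open>Quadratic operads and the black square product\<close>

text \<open>The space of generating operations has basis \<open>'b\<close>. A pair \<open>(u, v)\<close> stands for the relation
  \<open>u = v\<close>, where a basis vector \<open>(a, b)\<close> stands for \<open>(x a y) b z\<close> in \<open>u\<close> and for
  \<open>x a (y b z)\<close> in \<open>v\<close>.\<close>

type_synonym ('b, 'k) relation = "('b \<times> 'b \<Rightarrow>\<^sub>0 'k) \<times> ('b \<times> 'b \<Rightarrow>\<^sub>0 'k)"

definition relation_span :: "('b, 'k::field) relation set \<Rightarrow> ('b, 'k) relation set" where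
  "relation_span S =
    LinearCombinations.module.span class_ring (direct_sum (free_vs UNIV) (free_vs UNIV)) S"

definition relators :: "('b, 'k::field) relation set \<Rightarrow> nat \<Rightarrow> ('b tree \<Rightarrow>\<^sub>0 'k) set" where
  "relators \<Lambda> n = (if n = 3 then
    {lin_ext (\<lambda>(a, b). \<langle>\<langle>\<langle>\<rangle>, a, \<langle>\<rangle>\<rangle>, b, \<langle>\<rangle>\<rangle>) u - lin_ext (\<lambda>(a, b). \<langle>\<langle>\<rangle>, a, \<langle>\<langle>\<rangle>, b, \<langle>\<rangle>\<rangle>\<rangle>) v
      | u v. (u, v) \<in> \<Lambda>} else {})"

definition quadratic_operad ::
    "('b, 'k::field) relation set \<Rightarrow> ('k, ('b tree \<Rightarrow>\<^sub>0 'k) set) ns_operad" where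
  "quadratic_operad \<Lambda> = quotient_operad free_operad (generated_ideal free_operad (relators \<Lambda>))"

definition S23 :: "(('a \<times> 'a) \<times> ('b \<times> 'b) \<Rightarrow>\<^sub>0 'k::field) \<Rightarrow>
    (('a \<times> 'b) \<times> ('a \<times> 'b) \<Rightarrow>\<^sub>0 'k)" where
  "S23 = lin_ext (\<lambda>((a, a'), (b, b')). ((a, b), (a', b')))"

text \<open>Relations of the black square product of the quadratic operads with relations
  \<open>\<Lambda>\<^sub>1\<close> and \<open>\<Lambda>\<^sub>2\<close>.\<close>

definition black_square :: "('a, 'k::field) relation set \<Rightarrow> ('b, 'k) relation set \<Rightarrow>
    ('a \<times> 'b, 'k) relation set" (infixl \<open>\<box>\<close> 70) where
  "\<Lambda>\<^sub>1 \<box> \<Lambda>\<^sub>2 =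
    relation_span {(S23 (tensor u u'), S23 (tensor v v')) | u v u' v'.
      (u, v) \<in> \<Lambda>\<^sub>1 \<and> (u', v') \<in> \<Lambda>\<^sub>2}"


section \<open>The operads Dend and Quad\<close>

datatype dend_op = Prec | Succ

definition dend_relations :: "(dend_op, 'k::field) relation set" where
  "dend_relations =
    (let prec = Poly_Mapping.single Prec 1; succ = Poly_Mapping.single Succ 1; star = prec + succ
     in relation_span
       {(tensor prec prec, tensor prec star),
        (tensor succ prec, tensor succ prec),
        (tensor star succ, tensor succ succ)})"

definition Dend :: "('k::field, (dend_op tree \<Rightarrow>\<^sub>0 'k) set) ns_operad" where
  "Dend = quadratic_operad dend_relations"

definition Quad :: "('k::field, ((dend_op \<times> dend_op) tree \<Rightarrow>\<^sub>0 'k) set) ns_operad" where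
  "Quad = quadratic_operad (dend_relations \<box> dend_relations)"


section \<open>The components are vector spaces\<close>

lemma lookup_map_mult:
  "Poly_Mapping.lookup (Poly_Mapping.map ((*) c) p) x = (c::'k::field) * Poly_Mapping.lookup p x"
  by (simp add: Poly_Mapping.map.rep_eq when_def)

lemma vectorspace_free_vs: "vectorspace class_ring (free_vs X :: ('k::field, 'x \<Rightarrow>\<^sub>0 'k) module)"
proof -
  let ?V = "free_vs X :: ('k, 'x \<Rightarrow>\<^sub>0 'k) module"
  have closed: "Poly_Mapping.map ((*) c) p \<in> carrier ?V" if "p \<in> carrier ?V" for c p
    using that
    by (auto simp: free_vs_def in_keys_iff lookup_map_mult subset_iff)
  show ?thesis
  proof (rule vs_criteria)
    show "\<forall>v w. v \<in> carrier ?V \<and> w \<in> carrier ?V \<longrightarrow> v \<oplus>\<^bsub>?V\<^esub> w \<in> carrier ?V"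
      by (auto simp: free_vs_def dest!: subsetD[OF Poly_Mapping.keys_add])
    show "\<forall>v\<in>carrier ?V. \<exists>neg_v\<in>carrier ?V. v \<oplus>\<^bsub>?V\<^esub> neg_v = \<zero>\<^bsub>?V\<^esub>"
    proof
      fix v assume "v \<in> carrier ?V"
      then show "\<exists>neg_v\<in>carrier ?V. v \<oplus>\<^bsub>?V\<^esub> neg_v = \<zero>\<^bsub>?V\<^esub>"
        by (intro bexI[of _ "- v"]) (auto simp: free_vs_def in_keys_iff subset_iff)
    qed
    show "\<forall>c v. c \<in> carrier class_ring \<and> v \<in> carrier ?V \<longrightarrow> c \<odot>\<^bsub>?V\<^esub> v \<in> carrier ?V"
      using closed by (auto simp: free_vs_def)
  qed (auto simp: class_field free_vs_def algebra_simps lookup_add lookup_map_mult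
        intro!: poly_mapping_eqI)
qed

lemma module_quotient_module:
  fixes R :: "('k, 'm) ring_scheme" and M :: "('k, 'v) module"
  assumes N: "LinearCombinations.submodule R N M"
  shows "Module.module R (quotient_module M N)"
proof -
  interpret Module.module R M using N by (rule submodule.module)
  interpret N: LinearCombinations.submodule R N M by (rule N)
  have "subgroup N (add_monoid M)"
  proof (rule group.subgroupI)
    show "group (add_monoid M)" by (rule M.a_group)
    show "N \<subseteq> carrier (add_monoid M)" using N.subset by simp
    show "N \<noteq> {}" using N.zero_closed by blast
    fix a assume a: "a \<in> N"
    then have "\<ominus>\<^bsub>R\<^esub> \<one>\<^bsub>R\<^esub> \<odot>\<^bsub>M\<^esub> a \<in> N" by simp
    moreover have "\<ominus>\<^bsub>R\<^esub> \<one>\<^bsub>R\<^esub> \<odot>\<^bsub>M\<^esub> a = \<ominus>\<^bsub>M\<^esub> a"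
      using a N.subset smult_minus_1 by auto
    ultimately show "inv\<^bsub>add_monoid M\<^esub> a \<in> N" by (simp add: a_inv_def)
  qed auto
  then interpret N: abelian_subgroup N M
    by (intro abelian_subgroupI3 additive_subgroup.intro M.abelian_group_axioms)
  let ?Q = "quotient_module M N"
  have add: "(N +>\<^bsub>M\<^esub> x) \<oplus>\<^bsub>?Q\<^esub> (N +>\<^bsub>M\<^esub> y) = N +>\<^bsub>M\<^esub> (x \<oplus>\<^bsub>M\<^esub> y)"
    if "x \<in> carrier M" "y \<in> carrier M" for x y
    using that N.a_rcos_sum by (simp add: quotient_module_def)
  have smult: "c \<odot>\<^bsub>?Q\<^esub> (N +>\<^bsub>M\<^esub> x) = N +>\<^bsub>M\<^esub> (c \<odot>\<^bsub>M\<^esub> x)"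
    if c: "c \<in> carrier R" and x: "x \<in> carrier M" for c x
  proof -
    have *: "N +>\<^bsub>M\<^esub> (c \<odot>\<^bsub>M\<^esub> y) = N +>\<^bsub>M\<^esub> (c \<odot>\<^bsub>M\<^esub> x)" if y: "y \<in> N +>\<^bsub>M\<^esub> x" for y
    proof -
      obtain h where h: "h \<in> N" "y = h \<oplus>\<^bsub>M\<^esub> x"
        using y by (auto simp: a_r_coset_def r_coset_def)
      have "c \<odot>\<^bsub>M\<^esub> y = c \<odot>\<^bsub>M\<^esub> h \<oplus>\<^bsub>M\<^esub> c \<odot>\<^bsub>M\<^esub> x"
        using h c x N.subset by (simp add: smult_r_distr subset_iff)
      then have "c \<odot>\<^bsub>M\<^esub> y \<in> N +>\<^bsub>M\<^esub> (c \<odot>\<^bsub>M\<^esub> x)"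
        using h c by (auto simp: a_r_coset_def r_coset_def)
      then show ?thesis
        using N.a_repr_independence'[of "c \<odot>\<^bsub>M\<^esub> y" "c \<odot>\<^bsub>M\<^esub> x"] c x by simp
    qed
    have "x \<in> N +>\<^bsub>M\<^esub> x" using x N.a_rcos_self by simp
    then have "(\<Union>y\<in>N +>\<^bsub>M\<^esub> x. N +>\<^bsub>M\<^esub> (c \<odot>\<^bsub>M\<^esub> y)) = N +>\<^bsub>M\<^esub> (c \<odot>\<^bsub>M\<^esub> x)"
      using * by (intro UN_constant_eq) blast+
    then show ?thesis by (simp add: quotient_module_def)
  qed
  have car: "carrier ?Q = {N +>\<^bsub>M\<^esub> x | x. x \<in> carrier M}"
    by (auto simp: quotient_module_def A_RCOSETS_def' a_r_coset_def)
  have zero: "\<zero>\<^bsub>?Q\<^esub> = N +>\<^bsub>M\<^esub> \<zero>\<^bsub>M\<^esub>"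
    using M.a_coset_add_zero N.subset by (simp add: quotient_module_def)
  show ?thesis
  proof (rule moduleI)
    show "abelian_group ?Q"
    proof (rule abelian_groupI)
      fix A assume "A \<in> carrier ?Q"
      then obtain x where x: "x \<in> carrier M" "A = N +>\<^bsub>M\<^esub> x" by (auto simp: car)
      show "\<zero>\<^bsub>?Q\<^esub> \<oplus>\<^bsub>?Q\<^esub> A = A" using x add[of "\<zero>\<^bsub>M\<^esub>" x] by (simp add: zero)
      show "\<exists>B\<in>carrier ?Q. B \<oplus>\<^bsub>?Q\<^esub> A = \<zero>\<^bsub>?Q\<^esub>"
        using x add[of "\<ominus>\<^bsub>M\<^esub> x" x]
        by (intro bexI[of _ "N +>\<^bsub>M\<^esub> (\<ominus>\<^bsub>M\<^esub> x)"]) (auto simp: zero car M.l_neg)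
    next
      show "\<zero>\<^bsub>?Q\<^esub> \<in> carrier ?Q" by (auto simp: zero car)
    qed (auto simp: car add M.a_ac)
  next
    show "c \<odot>\<^bsub>?Q\<^esub> A \<in> carrier ?Q" if "c \<in> carrier R" "A \<in> carrier ?Q" for c A
      using that smult unfolding car by fastforce
  qed (auto simp: car add smult R.cring_axioms smult_l_distr smult_r_distr smult_assoc1)
qed

lemma size1_graft: "1 \<le> i \<Longrightarrow> i \<le> size1 t \<Longrightarrow> size1 (graft t i s) = size1 t + size1 s - 1"
proof (induction t arbitrary: i)
  case (Node l a r)
  have "size1 s > 0" by simp
  with Node show ?case by (auto simp: not_le)
qed auto

lemma keys_lin_ext: "Poly_Mapping.keys (lin_ext f p) \<subseteq> f ` Poly_Mapping.keys p"
  unfolding lin_ext_def by (rule order.trans[OF keys_sum]) auto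

lemma keys_tensor: "Poly_Mapping.keys (tensor p q) \<subseteq> Poly_Mapping.keys p \<times> Poly_Mapping.keys q"
  unfolding tensor_def
  by (intro order.trans[OF keys_sum] UN_least) (auto split: if_splits)

lemma partial_comp_free_operad:
  assumes "p \<in> carrier (component free_operad m)" "q \<in> carrier (component free_operad n)"
    "1 \<le> i" "i \<le> m"
  shows "partial_comp free_operad m n i p q \<in> carrier (component free_operad (m + n - 1))"
proof -
  have "Poly_Mapping.keys (partial_comp free_operad m n i p q) \<subseteq>
      (\<lambda>(t, s). graft t i s) ` (Poly_Mapping.keys p \<times> Poly_Mapping.keys q)"
    using keys_lin_ext keys_tensor by (fastforce simp: free_operad_def)
  then show ?thesis
    using assms size1_graft[of i] by (fastforce simp: free_operad_def free_vs_def)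
qed

lemma submodule_generated_ideal:
  assumes "\<And>n. R n \<subseteq> carrier (component (free_operad :: ('k::field, _) ns_operad) n)"
  shows "LinearCombinations.submodule class_ring (generated_ideal free_operad R n)
    (component (free_operad :: ('k, _) ns_operad) n)"
proof -
  let ?P = "free_operad :: ('k, _) ns_operad"
  have vs: "vectorspace class_ring (component ?P n)" for n
    using vectorspace_free_vs by (simp add: free_operad_def)
  then have m: "Module.module class_ring (component ?P n)" for n
    by (rule vectorspace.axioms)
  have "x \<in> carrier (component ?P n)" if "in_generated_ideal ?P R n x" for n x
    using that
  proof induction
    case (gen r n)
    then show ?case using assms by blast
  next
    case (zero n)
    interpret Module.module class_ring "component ?P n" by (rule m)
    show ?case by simp
  next
    case (add n x y)
    interpret Module.module class_ring "component ?P n" by (rule m)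
    show ?case using add by simp
  next
    case (smult n x c)
    interpret Module.module class_ring "component ?P n" by (rule m)
    show ?case using smult by simp
  qed (use partial_comp_free_operad in blast)+
  then show ?thesis
    by (intro submodule.intro m) (auto simp: generated_ideal_def intro: in_generated_ideal.intros)
qed

lemma relators_subset:
  "relators \<Lambda> n \<subseteq> carrier (component (free_operad :: ('k::field, _) ns_operad) n)"
proof -
  have *: "Poly_Mapping.keys (lin_ext f u - lin_ext g v) \<subseteq> {t. size1 t = 3}"
    if "\<And>x. size1 (f x) = 3" "\<And>x. size1 (g x) = 3"
    for f g :: "_ \<Rightarrow> 'b tree" and u v :: "_ \<Rightarrow>\<^sub>0 'k"
    using that keys_lin_ext[of f u] keys_lin_ext[of g v] keys_diff[of "lin_ext f u" "lin_ext g v"]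
    by blast
  show ?thesis
    by (auto simp: relators_def free_operad_def free_vs_def split: prod.splits
        dest!: subsetD[OF *, rotated 2])
qed

lemma vectorspace_quadratic_operad:
  "vectorspace class_ring (component (quadratic_operad \<Lambda> :: ('k::field, _) ns_operad) n)"
  unfolding quadratic_operad_def quotient_operad_def
  by (auto intro!: vectorspace.intro class_field module_quotient_module
      submodule_generated_ideal relators_subset)


end

theory Submission
  imports Defs "HOL-Computational_Algebra.Formal_Laurent_Series"
begin

text \<open>The component \<open>Quad(n)\<close> is computed by means of a basis. Replace the operations \<open>\<prec>\<close> and
  \<open>\<succ>\<close> of a dendriform algebra by \<open>\<prec>\<close> and \<open>* = \<prec> + \<succ>\<close>. In these generators the relations
  of Dend become rules that rewrite left combs into right combs,
    \<open>(x \<prec> y) \<prec> z = x \<prec> (y * z)\<close>,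
    \<open>(x * y) \<prec> z = x \<prec> (y * z) + x * (y \<prec> z) - x \<prec> (y \<prec> z)\<close>,
    \<open>(x * y) * z = x * (y * z)\<close>,
  and the only left comb that cannot be rewritten is \<open>(x \<prec> y) * z\<close>. All terms on the right are right
  combs, so rewriting a product \<open>t p z\<close> is a recursion on the tree \<open>t\<close>. The rules of a black square
  product are the products of the rules of its factors: in Quad a left comb can be rewritten if and
  only if both its components can. Call a tree reduced if it contains no such left comb. The reduced
  trees with \<open>n\<close> leaves give a basis of \<open>Quad(n)\<close>, for the following two reasons.

  They span: modulo the ideal of relations every tree can be rewritten
  (\<open>basis_eq_from_model_value\<close>).

  They are independent: on the vector space of all trees, let the recursive rewriting procedure
  define, for every operation \<open>p\<close>, a product \<open>mul p\<close>. These products satisfy the rules if the two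
  ways of rewriting a left comb with three nodes agree (\<open>mul_act\<close>), which is a finite condition on
  the coefficients of the rules, collected in the locale \<open>left_comb_rewriting\<close>. It is checked for
  Dend case by case and passes to black square products because all sums involved factor
  (\<open>left_comb_rewriting_pair\<close>). Thus the trees form an algebra over Quad. Evaluating elements
  of the free operad at the tree with one leaf kills the ideal (\<open>evaluate_ideal_eq_zero\<close>), but
  sends a reduced tree, with each \<open>*\<close> expanded into \<open>\<prec> + \<succ>\<close>, to itself
  (\<open>to_model_from_model_tree\<close>).

  It remains to count. Decomposing a reduced tree at its root gives
  \<open>T (1 - T) = X (1 + T)\<^sup>3\<close> for the generating series \<open>T\<close> of reduced trees
  (\<open>arity_gf_reduced_quad\<close>), and Lagrange inversion (\<open>fps_lagrange_inversion\<close>) yields the formula.\<close>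

section \<open>Lagrange inversion\<close>

lemma fps_compose_inverse_commute:
  fixes g T :: "'a::field_char_0 fps"
  assumes "g oo T = fps_X" "T $ 0 = 0" "g $ 0 = 0" "g $ 1 \<noteq> 0"
  shows "T oo g = fps_X"
proof -
  have "fps_inv g = fps_inv g oo (g oo T)" unfolding assms(1) by simp
  also have "\<dots> = (fps_inv g oo g) oo T" using assms by (intro fps_compose_assoc)
  also have "\<dots> = T" using assms by (simp add: fps_inv fps_X_fps_compose_startby0)
  finally show ?thesis using assms fps_inv[of g] by simp
qed

text \<open>For \<open>k \<noteq> -1\<close> the product is, up to the factor \<open>k + 1\<close>, the derivative of a power of \<open>G\<close>, and
  derivatives have no residue. For \<open>k = -1\<close> it is the logarithmic derivative, whose residue is the
  order of \<open>G\<close> at zero.\<close>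

lemma fls_residue_powi_times_deriv:
  fixes G :: "'a::field_char_0 fls"
  assumes "G \<noteq> 0"
  shows "fls_residue (G powi k * fls_deriv G) = (if k = -1 then of_int (fls_subdegree G) else 0)"
proof (cases "k = -1")
  case True
  then show ?thesis using fls_residue_deriv_times_inverse_eq_subdegree(2)[of G] by simp
next
  case False
  have pow: "fls_deriv (G ^ m) = of_nat m * G powi (int m - 1) * fls_deriv G" for m
    unfolding fls_deriv_power by (cases m) simp_all
  have "fls_deriv (G powi j) = of_int j * G powi (j - 1) * fls_deriv G" for j
  proof (cases "j \<ge> 0")
    case True
    then obtain m where "j = int m" using nonneg_int_cases by blast
    then show ?thesis using pow[of m] by simp
  next
    case False
    define m where "m = nat (- j)"
    have j: "j = - int m" using False by (simp add: m_def)
    have "0 = fls_deriv (G ^ m * G powi j)"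
      using assms by (simp add: j power_int_minus)
    also have "\<dots> = of_nat m * G powi (int m - 1) * fls_deriv G * G powi j + G ^ m * fls_deriv (G powi j)"
      by (simp add: pow)
    finally have "G powi m * fls_deriv (G powi j) = - of_nat m * G powi (int m - 1) * fls_deriv G * G powi j"
      by (simp add: eq_neg_iff_add_eq_0 add.commute)
    also have "\<dots> = G powi m * (of_int j * G powi (j - 1) * fls_deriv G)"
      using assms by (simp add: j power_int_minus power_int_diff field_simps)
    finally show ?thesis using assms by simp
  qed
  from this[of "k + 1"] have "fls_deriv (G powi (k + 1)) = fls_const (of_int (k + 1)) * (G powi k * fls_deriv G)"
    by (simp add: fls_of_int mult.assoc)
  then have "of_int (k + 1) * fls_residue (G powi k * fls_deriv G) = 0"
    using fls_residue_deriv[of "G powi (k + 1)"] by (metis fls_residue_fls_const_times(1))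
  moreover have "of_int (k + 1) \<noteq> (0 :: 'a)"
    using False by (metis add.commute add_cancel_right_right add_eq_0_iff of_int_eq_0_iff)
  ultimately show ?thesis using False by simp
qed

lemma fps_to_fls_sum: "fps_to_fls (\<Sum>x\<in>A. f x) = (\<Sum>x\<in>A. fps_to_fls (f x))"
  by (induction A rule: infinite_finite_induct) auto

text \<open>The series \<open>g = X / f\<close> is the compositional inverse of \<open>T\<close>. Differentiating \<open>T(g) = X\<close>
  gives \<open>1 = T'(g) g'\<close>. Divide this by \<open>g\<^sup>n\<close> and compare residues: on the right only the term
  \<open>n T\<^sub>n g'/g\<close> contributes, while on the left \<open>g\<^sup>-\<^sup>n = X\<^sup>-\<^sup>n f\<^sup>n\<close> has the coefficient of
  \<open>X\<^sup>n\<^sup>-\<^sup>1\<close> in \<open>f\<^sup>n\<close> as its residue.\<close>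

theorem fps_lagrange_inversion:
  fixes f T :: "'a::field_char_0 fps"
  assumes T: "T = fps_X * (f oo T)" and f0: "f $ 0 \<noteq> 0" and n: "n > 0"
  shows "of_nat n * T $ n = f ^ n $ (n - 1)"
proof -
  have T0: "T $ 0 = 0" by (subst T) simp
  define g where "g = fps_X * inverse f"
  have g0: "g $ 0 = 0" and g1: "g $ 1 \<noteq> 0" using f0 by (simp_all add: g_def)
  have fT: "(f oo T) $ 0 \<noteq> 0" using f0 by simp
  have "g oo T = T * inverse (f oo T)"
    using T0 f0 by (simp add: g_def fps_compose_mult_distrib fps_inverse_compose fps_X_fps_compose_startby0)
  also have "\<dots> = fps_X * ((f oo T) * inverse (f oo T))"
    using T by (metis mult.assoc)
  finally have "g oo T = fps_X" using fT by (simp add: inverse_mult_eq_1')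
  then have Tg: "T oo g = fps_X" by (rule fps_compose_inverse_commute[OF _ T0 g0 g1])
  have one: "1 = (fps_deriv T oo g) * fps_deriv g"
    using fps_compose_deriv[OF g0, of T] by (simp add: Tg)
  define R where "R = fps_shift n (fps_deriv T)"
  \<comment> \<open>The part of \<open>T'(g)\<close> from \<open>g\<^sup>n\<close> on has no residue after division by \<open>g\<^sup>n\<close>.\<close>
  have split: "fps_deriv T = fps_cutoff n (fps_deriv T) + R * fps_X ^ n"
    using fps_shift_cutoff[of n "fps_deriv T"] by (simp add: R_def add.commute)
  define c where "c = (\<lambda>k. of_nat (k + 1) * T $ (k + 1))"
  have cut: "fps_cutoff n (fps_deriv T) = (\<Sum>k<n. fps_const (c k) * fps_X ^ k)"
    by (simp add: fps_eq_iff fps_sum_nth c_def if_distrib cong: if_cong)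
  have "fps_deriv T oo g = (\<Sum>k<n. fps_const (c k) * g ^ k) + (R oo g) * g ^ n"
    by (subst split) (simp add: cut fps_compose_add_distrib fps_compose_sum_distrib
        fps_compose_mult_distrib g0 fps_X_fps_compose_startby0 flip: fps_compose_power)
  with one have "1 = (\<Sum>k<n. fps_const (c k) * (g ^ k * fps_deriv g)) + (R oo g) * g ^ n * fps_deriv g"
    by (simp add: distrib_right sum_distrib_right mult.assoc)
  define G where "G = fps_to_fls g"
  have "G \<noteq> 0" using g1 by (auto simp: G_def)
  have "subdegree g = 1"
    using g0 g1 by (intro subdegreeI) auto
  then have subdeg: "fls_subdegree G = 1" by (simp add: G_def fls_subdegree_fls_to_fps)
  have Gn: "G powi (- int n) * G ^ k = G powi (int k - int n)" for k
    using \<open>G \<noteq> 0\<close> by (simp add: power_int_diff power_int_minus field_simps)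
  have "1 = (\<Sum>k<n. fls_const (c k) * (G ^ k * fls_deriv G)) +
      G ^ n * fps_to_fls ((R oo g) * fps_deriv g)"
    using arg_cong[OF \<open>1 = _ + _\<close>, of fps_to_fls]
    by (simp add: fls_times_fps_to_fls fps_to_fls_sum fps_to_fls_power G_def fls_deriv_fps_to_fls mult_ac)
  then have "G powi (- int n) = G powi (- int n) * ((\<Sum>k<n. fls_const (c k) * (G ^ k * fls_deriv G)) +
      G ^ n * fps_to_fls ((R oo g) * fps_deriv g))"
    by simp
  also have "\<dots> = (\<Sum>k<n. fls_const (c k) * ((G powi (- int n) * G ^ k) * fls_deriv G)) +
      (G powi (- int n) * G ^ n) * fps_to_fls ((R oo g) * fps_deriv g)"
    by (simp add: distrib_left sum_distrib_left mult_ac)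
  finally have "fls_residue (G powi (- int n)) =
      (\<Sum>k<n. c k * fls_residue (G powi (int k - int n) * fls_deriv G))"
    by (simp add: Gn fls_nth_sum)
  also have "\<dots> = (\<Sum>k<n. if k = n - 1 then c k else 0)"
    using n subdeg
    by (intro sum.cong refl) (auto simp: fls_residue_powi_times_deriv[OF \<open>G \<noteq> 0\<close>] simp del: fls_residue_def)
  also have "\<dots> = of_nat n * T $ n" using n by (simp add: c_def)
  finally have res: "fls_residue (G powi (- int n)) = of_nat n * T $ n" .
  have "g * f = fps_X" using f0 by (simp add: g_def mult.assoc inverse_mult_eq_1)
  then have "g ^ n * f ^ n = fps_X ^ n" by (metis power_mult_distrib)
  then have "G ^ n * fps_to_fls (f ^ n) = fls_X ^ n"
    by (metis G_def fls_times_fps_to_fls fps_to_fls_power fps_X_to_fls)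
  then have "fls_X_intpow (- int n) * fls_X ^ n = fls_X_intpow (- int n) * (G ^ n * fps_to_fls (f ^ n))"
    by (rule arg_cong[OF sym])
  moreover have "fls_X_intpow (- int n) * fls_X ^ n = (1 :: 'a fls)"
    using fls_X_intpow_times_fls_X_intpow[of "- int n" "int n", where ?'a = 'a]
    by (simp add: fls_X_power_conv_shift_1)
  ultimately have "G powi (- int n) =
      G powi (- int n) * (fls_X_intpow (- int n) * (G ^ n * fps_to_fls (f ^ n)))"
    by (simp only: mult_1_right)
  also have "\<dots> = (G powi (- int n) * G ^ n) * (fls_X_intpow (- int n) * fps_to_fls (f ^ n))"
    by (simp only: mult_ac)
  also have "\<dots> = fls_X_intpow (- int n) * fps_to_fls (f ^ n)"
    using Gn[of n] by simp
  finally have "G powi (- int n) = fls_X_intpow (- int n) * fps_to_fls (f ^ n)" .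
  then have "fls_residue (G powi (- int n)) = f ^ n $ (n - 1)"
    using fls_residue_shift_nth[of "fps_to_fls (f ^ n)" "int n - 1"] n by (simp add: nat_diff_distrib)
  with res show ?thesis by simp
qed

lemma inverse_one_minus_fps_X_power_nth:
  assumes "n > 0"
  shows "(inverse (1 - fps_X) ^ n :: 'a::field_char_0 fps) $ i = of_nat ((n + i - 1) choose i)"
proof -
  have "(inverse (1 - fps_X) ^ n :: 'a fps) = fps_binomial (- of_nat n) oo - fps_X"
    using one_minus_fps_X_const_neg_power[of 1 n] by (simp add: fps_inverse_power)
  also have "\<dots> = Abs_fps (\<lambda>i. (- 1) ^ i * (- of_nat n gchoose i))"
    using fps_compose_linear[of "fps_binomial (- of_nat n :: 'a)" "-1"] by (simp flip: fps_const_neg)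
  finally have "(inverse (1 - fps_X) ^ n :: 'a fps) $ i = (-1) ^ i * ((- of_nat n) gchoose i)"
    by (metis fps_nth_Abs_fps)
  also have "\<dots> = of_nat ((n + i - 1) choose i)"
    using assms by (simp add: gbinomial_minus of_nat_diff binomial_gbinomial algebra_simps flip: power_add)
  finally show ?thesis .
qed

text \<open>The functional equation is \<open>T = X f(T)\<close> with \<open>f(u) = (1 + u)\<^sup>3 / (1 - u)\<close>. The sum is the
  convolution of the coefficients of \<open>(1 - u)\<^sup>-\<^sup>n\<close> at \<open>i\<close> and of \<open>(1 + u)\<^sup>3\<^sup>n\<close> at
  \<open>n - 1 - i\<close>, indexed by \<open>j = n + i\<close>.\<close>

lemma coeff_of_quad_functional_equation:
  fixes T :: "'a::field_char_0 fps"
  assumes T: "T * (1 - T) = fps_X * (1 + T) ^ 3" "T $ 0 = 0" and n: "n > 0"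
  shows "of_nat n * T $ n =
    (\<Sum>j = n..2 * n - 1. of_nat (((3 * n) choose (n + 1 + j)) * ((j - 1) choose (j - n))))"
proof -
  define f :: "'a fps" where "f = (1 + fps_X) ^ 3 * inverse (1 - fps_X)"
  have "f oo T = (1 + T) ^ 3 * inverse (1 - T)"
    using T(2) by (simp add: f_def fps_compose_mult_distrib fps_inverse_compose fps_compose_add_distrib
        fps_compose_sub_distrib flip: fps_compose_power)
  then have "fps_X * (f oo T) = T * (1 - T) * inverse (1 - T)" using T by (simp add: mult.assoc)
  also have "\<dots> = T" using T(2) by (simp add: mult.assoc inverse_mult_eq_1')
  finally have "of_nat n * T $ n = f ^ n $ (n - 1)"
    using n by (intro fps_lagrange_inversion) (simp_all add: f_def)
  also have "f ^ n = inverse (1 - fps_X) ^ n * (1 + fps_X) ^ (3 * n)"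
    unfolding f_def power_mult_distrib power_mult by (rule mult.commute)
  also have "\<dots> $ (n - 1) = (\<Sum>i=0..n-1. of_nat ((n + i - 1) choose i) * of_nat ((3 * n) choose (n - 1 - i)))"
    using n by (simp add: fps_mult_nth inverse_one_minus_fps_X_power_nth binomial_gbinomial
        flip: fps_binomial_of_nat)
  also have "\<dots> = (\<Sum>j = n..2 * n - 1. of_nat (((3 * n) choose (n + 1 + j)) * ((j - 1) choose (j - n))))"
  proof (rule sum.reindex_bij_witness[of _ "\<lambda>j. j - n" "\<lambda>i. n + i"])
    fix i assume i: "i \<in> {0..n - 1}"
    then have "(3 * n) choose (n - 1 - i) = (3 * n) choose (n + 1 + (n + i))"
      using n by (subst binomial_symmetric) (auto intro!: arg_cong[where f = "(choose) (3 * n)"])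
    then show "of_nat (((3 * n) choose (n + 1 + (n + i))) * ((n + i - 1) choose (n + i - n))) =
        (of_nat ((n + i - 1) choose i) * of_nat ((3 * n) choose (n - 1 - i)) :: 'a)"
      by simp
  qed (use n in auto)
  finally show ?thesis .
qed

section \<open>Linear maps between spaces with a basis\<close>

abbreviation scale_pm :: "'k::field \<Rightarrow> ('x \<Rightarrow>\<^sub>0 'k) \<Rightarrow> ('x \<Rightarrow>\<^sub>0 'k)" (infixr \<open>\<cdot>\<close> 75) where
  "c \<cdot> p \<equiv> Poly_Mapping.map ((*) c) p"

abbreviation basis_vec :: "'x \<Rightarrow> ('x \<Rightarrow>\<^sub>0 'k::field)" where
  "basis_vec x \<equiv> Poly_Mapping.single x 1"

interpretation pm: vector_space "scale_pm :: 'k::field \<Rightarrow> ('x \<Rightarrow>\<^sub>0 'k) \<Rightarrow> _"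
  by standard (auto intro!: poly_mapping_eqI simp: lookup_map_mult lookup_add algebra_simps)

definition linear_pm :: "(('x \<Rightarrow>\<^sub>0 'k::field) \<Rightarrow> ('y \<Rightarrow>\<^sub>0 'k)) \<Rightarrow> bool" where
  "linear_pm f \<longleftrightarrow> (\<forall>p q. f (p + q) = f p + f q) \<and> (\<forall>c p. f (c \<cdot> p) = c \<cdot> f p)"

lemma linear_pm_add: "linear_pm f \<Longrightarrow> f (p + q) = f p + f q"
  and linear_pm_scale: "linear_pm f \<Longrightarrow> f (c \<cdot> p) = c \<cdot> f p"
  by (auto simp: linear_pm_def)

lemma linear_pm_zero: "linear_pm f \<Longrightarrow> f 0 = 0"
  using linear_pm_add[of f 0 0] by simp

lemma linear_pm_minus: "linear_pm f \<Longrightarrow> f (- p) = - f p"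
  using linear_pm_scale[of f "-1" p] by (simp add: pm.scale_minus_left)

lemma linear_pm_diff: "linear_pm f \<Longrightarrow> f (p - q) = f p - f q"
  using linear_pm_add[of f p "- q"] by (simp add: linear_pm_minus)

lemma linear_pm_sum: "linear_pm f \<Longrightarrow> f (\<Sum>i\<in>I. p i) = (\<Sum>i\<in>I. f (p i))"
  by (induction I rule: infinite_finite_induct) (simp_all add: linear_pm_zero linear_pm_add)

lemma linear_pm_comp: "linear_pm f \<Longrightarrow> linear_pm g \<Longrightarrow> linear_pm (\<lambda>p. f (g p))"
  by (simp add: linear_pm_def)

lemma linear_pm_ident: "linear_pm (\<lambda>p. p)"
  by (simp add: linear_pm_def)

lemma linear_pm_plus: "linear_pm f \<Longrightarrow> linear_pm g \<Longrightarrow> linear_pm (\<lambda>p. f p + g p)"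
  by (simp add: linear_pm_def pm.scale_right_distrib)

lemma linear_pm_sub: "linear_pm f \<Longrightarrow> linear_pm g \<Longrightarrow> linear_pm (\<lambda>p. f p - g p)"
  by (simp add: linear_pm_def pm.scale_right_diff_distrib)

lemma linear_pm_scaled: "linear_pm f \<Longrightarrow> linear_pm (\<lambda>p. c \<cdot> f p)"
  by (simp add: linear_pm_def pm.scale_right_distrib mult.commute)

lemma linear_pm_summed: "(\<And>i. i \<in> I \<Longrightarrow> linear_pm (f i)) \<Longrightarrow> linear_pm (\<lambda>p. \<Sum>i\<in>I. f i p)"
  by (simp add: linear_pm_def sum.distrib pm.scale_sum_right)

lemma pm_eq_sum_keys:
  "p = (\<Sum>x\<in>Poly_Mapping.keys p. Poly_Mapping.lookup p x \<cdot> basis_vec x)"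
  by (rule poly_mapping_eqI)
    (auto simp: lookup_sum lookup_map_mult lookup_single when_def in_keys_iff if_distrib cong: if_cong)

lemma linear_pm_eqI:
  fixes f g :: "('x \<Rightarrow>\<^sub>0 'k::field) \<Rightarrow> ('y \<Rightarrow>\<^sub>0 'k)"
  assumes "linear_pm f" "linear_pm g"
    and eq: "\<And>x. x \<in> Poly_Mapping.keys p \<Longrightarrow> f (basis_vec x) = g (basis_vec x)"
  shows "f p = g p"
proof -
  have expand: "h p = (\<Sum>x\<in>Poly_Mapping.keys p. Poly_Mapping.lookup p x \<cdot> h (basis_vec x))"
    if "linear_pm h" for h :: "('x \<Rightarrow>\<^sub>0 'k) \<Rightarrow> ('y \<Rightarrow>\<^sub>0 'k)"
    using arg_cong[OF pm_eq_sum_keys, of h p]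
    by (simp only: linear_pm_sum[OF that] linear_pm_scale[OF that])
  show ?thesis
    unfolding expand[OF assms(1)] expand[OF assms(2)] by (simp add: eq)
qed

text \<open>The linear extension of an arbitrary vector-valued function on the basis, of which \<open>lin_ext\<close> is the
  case where basis vectors go to basis vectors.\<close>

definition lin_map :: "('x \<Rightarrow> ('y \<Rightarrow>\<^sub>0 'k::field)) \<Rightarrow> ('x \<Rightarrow>\<^sub>0 'k) \<Rightarrow> ('y \<Rightarrow>\<^sub>0 'k)" where
  "lin_map f p = (\<Sum>x\<in>Poly_Mapping.keys p. Poly_Mapping.lookup p x \<cdot> f x)"

lemma lin_map_superset:
  "finite X \<Longrightarrow> Poly_Mapping.keys p \<subseteq> X \<Longrightarrow> lin_map f p = (\<Sum>x\<in>X. Poly_Mapping.lookup p x \<cdot> f x)"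
  unfolding lin_map_def by (rule sum.mono_neutral_left) (auto simp: in_keys_iff)

lemma linear_lin_map: "linear_pm (lin_map f)"
proof -
  have "lin_map f (p + q) = lin_map f p + lin_map f q" for p q
    using Poly_Mapping.keys_add[of p q]
    by (simp add: lin_map_superset[of "Poly_Mapping.keys p \<union> Poly_Mapping.keys q"] lookup_add
        pm.scale_left_distrib sum.distrib)
  moreover have "lin_map f (c \<cdot> p) = c \<cdot> lin_map f p" for c p
  proof -
    have "Poly_Mapping.keys (c \<cdot> p) \<subseteq> Poly_Mapping.keys p"
      by (auto simp: in_keys_iff lookup_map_mult)
    then show ?thesis
      by (simp add: lin_map_superset[of "Poly_Mapping.keys p"] lookup_map_mult pm.scale_sum_right)
  qed
  ultimately show ?thesis by (simp add: linear_pm_def)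
qed

lemma lin_map_basis [simp]: "lin_map f (basis_vec x) = f x"
  by (simp add: lin_map_def)

lemmas lin_map_add [simp] = linear_pm_add[OF linear_lin_map]
  and lin_map_scale [simp] = linear_pm_scale[OF linear_lin_map]
  and lin_map_zero [simp] = linear_pm_zero[OF linear_lin_map]
  and lin_map_diff [simp] = linear_pm_diff[OF linear_lin_map]

lemma lin_map_lin_map: "lin_map f (lin_map g p) = lin_map (\<lambda>x. lin_map f (g x)) p"
  by (rule linear_pm_eqI[of "\<lambda>p. lin_map f (lin_map g p)"])
    (simp_all add: linear_pm_comp linear_lin_map)

lemma lin_map_cong: "(\<And>x. x \<in> Poly_Mapping.keys p \<Longrightarrow> f x = g x) \<Longrightarrow> lin_map f p = lin_map g p"
  by (simp add: lin_map_def)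

lemma linear_lin_map_family:
  "(\<And>x. linear_pm (\<lambda>q. f q x)) \<Longrightarrow> linear_pm (\<lambda>q. lin_map (f q) p)"
  unfolding lin_map_def by (intro linear_pm_summed linear_pm_scaled)

lemma keys_lin_map:
  "Poly_Mapping.keys (lin_map f p) \<subseteq> (\<Union>x\<in>Poly_Mapping.keys p. Poly_Mapping.keys (f x))"
  unfolding lin_map_def
  by (rule order.trans[OF keys_sum]) (auto simp: in_keys_iff lookup_map_mult)

lemma lin_ext_eq_lin_map: "lin_ext f = lin_map (\<lambda>x. basis_vec (f x))"
proof
  fix p :: "'a \<Rightarrow>\<^sub>0 'b"
  have "Poly_Mapping.single y c = c \<cdot> basis_vec y" for y :: 'c and c :: 'b
    by (rule poly_mapping_eqI) (simp add: lookup_map_mult lookup_single when_def)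
  then show "lin_ext f p = lin_map (\<lambda>x. basis_vec (f x)) p"
    by (simp add: lin_ext_def lin_map_def)
qed

lemma tensor_eq_lin_map: "tensor p q = lin_map (\<lambda>x. lin_map (\<lambda>y. basis_vec (x, y)) q) p"
proof -
  have "Poly_Mapping.single y (a * b) = a \<cdot> b \<cdot> basis_vec y" for y :: "'a \<times> 'b" and a b :: 'c
    by (rule poly_mapping_eqI) (simp add: lookup_map_mult lookup_single when_def)
  then show ?thesis
    by (simp add: tensor_def lin_map_def pm.scale_sum_right)
qed

lemma linear_tensor: "linear_pm (\<lambda>p. tensor p q)" "linear_pm (\<lambda>q. tensor p q)"
  unfolding tensor_eq_lin_map by (intro linear_lin_map linear_lin_map_family)+

lemma tensor_basis [simp]: "tensor (basis_vec x) (basis_vec y) = basis_vec (x, y)"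
  by (simp add: tensor_eq_lin_map)

lemma lin_map_swap:
  "lin_map (\<lambda>x. lin_map (\<lambda>y. f x y) q) p = lin_map (\<lambda>y. lin_map (\<lambda>x. f x y) p) q"
  by (rule linear_pm_eqI[where p = p]) (auto intro: linear_lin_map linear_lin_map_family)

lemma linear_pm_lin_map: "linear_pm h \<Longrightarrow> h (lin_map g p) = lin_map (\<lambda>x. h (g x)) p"
  by (rule linear_pm_eqI[where p = p])
    (simp_all add: linear_lin_map linear_pm_comp)

lemma lin_map_const_zero: "lin_map (\<lambda>_. 0) p = 0"
  by (simp add: lin_map_def)

section \<open>Confluent rewriting of left combs\<close>

lemma sum_swap_pairs:
  "(\<Sum>a\<in>A. \<Sum>b\<in>B. \<Sum>c\<in>C. \<Sum>d\<in>D. f a b c d) = (\<Sum>c\<in>C. \<Sum>d\<in>D. \<Sum>a\<in>A. \<Sum>b\<in>B. f a b c d)"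
  by (simp only: sum.cartesian_product[of _ B A] sum.cartesian_product[of _ D C])
    (simp only: split_def, rule sum.swap)

lemma sum_rotate:
  "(\<Sum>b\<in>B. \<Sum>c\<in>C. \<Sum>d\<in>D. \<Sum>e\<in>E. f b c d e) = (\<Sum>d\<in>D. \<Sum>c\<in>C. \<Sum>e\<in>E. \<Sum>b\<in>B. f b c d e)"
proof -
  have "(\<Sum>b\<in>B. \<Sum>c\<in>C. \<Sum>d\<in>D. \<Sum>e\<in>E. f b c d e) = (\<Sum>d\<in>D. \<Sum>e\<in>E. \<Sum>b\<in>B. \<Sum>c\<in>C. f b c d e)"
    by (rule sum_swap_pairs)
  also have "\<dots> = (\<Sum>d\<in>D. \<Sum>e\<in>E. \<Sum>c\<in>C. \<Sum>b\<in>B. f b c d e)"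
    by (intro sum.cong[OF refl]) (rule sum.swap)
  also have "\<dots> = (\<Sum>d\<in>D. \<Sum>c\<in>C. \<Sum>e\<in>E. \<Sum>b\<in>B. f b c d e)"
    by (rule sum.cong[OF refl], rule sum.swap)
  finally show ?thesis .
qed

text \<open>\<open>lead a p\<close> says that the left comb \<open>(x a y) p z\<close> is rewritten, namely into
  \<open>\<Sum>b c. K a p b c (x b (y c z))\<close>. The last four assumptions concern the left combs
  \<open>((x q w) a y) p z\<close> in which both pairs of adjacent nodes can be rewritten. Start with the inner
  pair: by \<open>first_lead\<close> each resulting \<open>(x b (w c y)) p z\<close> can be rewritten at the root, giving
  terms \<open>x d ((w c y) e z)\<close>; by \<open>stuck\<close> those terms whose right part cannot be rewritten cancel, and
  the others become \<open>x d (w f (y g z))\<close>. Start with the outer pair: by \<open>second_lead\<close> each resulting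
  \<open>(x q w) b (y g z)\<close> can be rewritten, again into terms \<open>x d (w f (y g z))\<close>. Finally,
  \<open>confluent\<close> says that both results agree.\<close>

locale left_comb_rewriting =
  fixes lead :: "'o::finite \<Rightarrow> 'o \<Rightarrow> bool" and K :: "'o \<Rightarrow> 'o \<Rightarrow> 'o \<Rightarrow> 'o \<Rightarrow> 'k::field"
  assumes coeff_lead: "K a p b c \<noteq> 0 \<Longrightarrow> lead a p"
    and first_lead: "lead q a \<Longrightarrow> lead a p \<Longrightarrow> K q a b c \<noteq> 0 \<Longrightarrow> lead b p"
    and second_lead: "lead q a \<Longrightarrow> lead a p \<Longrightarrow> K a p b c \<noteq> 0 \<Longrightarrow> lead q b"
    and stuck: "lead q a \<Longrightarrow> lead a p \<Longrightarrow> \<not> lead c e \<Longrightarrow> (\<Sum>b\<in>UNIV. K q a b c * K b p d e) = 0"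
    and confluent: "lead q a \<Longrightarrow> lead a p \<Longrightarrow>
      (\<Sum>c\<in>UNIV. \<Sum>e\<in>UNIV. (\<Sum>b\<in>UNIV. K q a b c * K b p d e) * K c e f g) =
      (\<Sum>b\<in>UNIV. K a p b g * K q b d f)"
begin

text \<open>For a reduced tree \<open>t\<close> and a combination \<open>z\<close> of reduced trees, this is the normal form of
  \<open>t p z\<close>. The recursion is on \<open>t\<close> alone because all results of the rules are right combs.\<close>

primrec act :: "'o tree \<Rightarrow> 'o \<Rightarrow> ('o tree \<Rightarrow>\<^sub>0 'k) \<Rightarrow> ('o tree \<Rightarrow>\<^sub>0 'k)" where
  "act \<langle>\<rangle> p z = lin_map (\<lambda>s. basis_vec \<langle>\<langle>\<rangle>, p, s\<rangle>) z"
| "act \<langle>u, q, w\<rangle> p z =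
    (if lead q p then \<Sum>b\<in>UNIV. \<Sum>c\<in>UNIV. K q p b c \<cdot> act u b (act w c z)
     else lin_map (\<lambda>s. basis_vec \<langle>\<langle>u, q, w\<rangle>, p, s\<rangle>) z)"

definition mul :: "'o \<Rightarrow> ('o tree \<Rightarrow>\<^sub>0 'k) \<Rightarrow> ('o tree \<Rightarrow>\<^sub>0 'k) \<Rightarrow> ('o tree \<Rightarrow>\<^sub>0 'k)" where
  "mul p x z = lin_map (\<lambda>t. act t p z) x"

lemma linear_act: "linear_pm (act t p)"
proof (induction t arbitrary: p)
  case (Node u q w)
  then show ?case
    by (cases "lead q p") (auto intro!: linear_pm_summed linear_pm_scaled linear_lin_map
        intro: linear_pm_comp[of "act u _" "act w _"])
qed (simp add: linear_lin_map[unfolded linear_pm_def] linear_pm_def)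

lemma linear_mul: "linear_pm (\<lambda>x. mul p x z)" "linear_pm (mul p x)"
  unfolding mul_def by (intro linear_lin_map linear_lin_map_family linear_act)+

lemma mul_basis [simp]: "mul p (basis_vec t) z = act t p z"
  by (simp add: mul_def)

text \<open>If \<open>t a y\<close> is irreducible, then the rule for \<open>(t a y) p z\<close> holds by the definition of \<open>act\<close>.\<close>

lemma mul_grafted:
  assumes "lead a p"
  shows "mul p (lin_map (\<lambda>s. basis_vec \<langle>t, a, s\<rangle>) y) z =
    (\<Sum>b\<in>UNIV. \<Sum>c\<in>UNIV. K a p b c \<cdot> act t b (mul c y z))"
proof (rule linear_pm_eqI[where p = y])
  show "linear_pm (\<lambda>y. mul p (lin_map (\<lambda>s. basis_vec \<langle>t, a, s\<rangle>) y) z)"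
    by (rule linear_pm_comp[OF linear_mul(1) linear_lin_map])
  show "linear_pm (\<lambda>y. \<Sum>b\<in>UNIV. \<Sum>c\<in>UNIV. K a p b c \<cdot> act t b (mul c y z))"
    by (intro linear_pm_summed linear_pm_scaled linear_pm_comp[OF linear_act linear_mul(1)])
qed (use assms in simp)

text \<open>If \<open>t = \<langle>u, q, w\<rangle>\<close> and the pair \<open>q a\<close> can be rewritten, then the two sides are the two ways of
  rewriting a left comb with three nodes, and they agree by confluence. On the left the definition of
  \<open>act\<close> rewrites the inner pair, the induction hypothesis for \<open>u\<close> then rewrites at the root and the
  one for \<open>w\<close> in the right part; on the right the definition of \<open>act\<close> does the second step.
  Otherwise the claim is \<open>mul_grafted\<close>.\<close>

lemma mul_act:
  assumes "lead a p"
  shows "mul p (act t a y) z = (\<Sum>b\<in>UNIV. \<Sum>c\<in>UNIV. K a p b c \<cdot> act t b (mul c y z))"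
  using assms
proof (induction t arbitrary: a p y z)
  case Leaf
  then show ?case using mul_grafted[of a p \<open>\<langle>\<rangle>\<close>] by simp
next
  case (Node u q w)
  show ?case
  proof (cases "lead q a")
    case False
    then show ?thesis using mul_grafted[OF Node.prems, of "\<langle>u, q, w\<rangle>"] by simp
  next
    case True
    define F where "F d f g = act u d (act w f (mul g y z))" for d f g
    define M where "M d c e = (\<Sum>b\<in>UNIV. K q a b c * K b p d e)" for d c e
    have "mul p (act \<langle>u, q, w\<rangle> a y) z =
        (\<Sum>b\<in>UNIV. \<Sum>c\<in>UNIV. K q a b c \<cdot> mul p (act u b (act w c y)) z)"
      using True by (simp add: linear_pm_sum[OF linear_mul(1)] linear_pm_scale[OF linear_mul(1)])
    \<comment> \<open>Rewrite at the root, which is possible for all terms with nonzero coefficient.\<close>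
    also have "\<dots> = (\<Sum>b\<in>UNIV. \<Sum>c\<in>UNIV. K q a b c \<cdot>
        (\<Sum>d\<in>UNIV. \<Sum>e\<in>UNIV. K b p d e \<cdot> act u d (mul e (act w c y) z)))"
    proof (intro sum.cong refl)
      fix b c
      show "K q a b c \<cdot> mul p (act u b (act w c y)) z = K q a b c \<cdot>
        (\<Sum>d\<in>UNIV. \<Sum>e\<in>UNIV. K b p d e \<cdot> act u d (mul e (act w c y) z))"
        using first_lead[OF True Node.prems] Node.IH(1)[of b p] by (cases "K q a b c = 0") auto
    qed
    also have "\<dots> = (\<Sum>b\<in>UNIV. \<Sum>c\<in>UNIV. \<Sum>d\<in>UNIV. \<Sum>e\<in>UNIV.
        (K q a b c * K b p d e) \<cdot> act u d (mul e (act w c y) z))"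
      by (simp add: pm.scale_sum_right)
    also have "\<dots> = (\<Sum>d\<in>UNIV. \<Sum>c\<in>UNIV. \<Sum>e\<in>UNIV. M d c e \<cdot> act u d (mul e (act w c y) z))"
      unfolding M_def pm.scale_sum_left by (rule sum_rotate)
    \<comment> \<open>If \<open>c e\<close> cannot be rewritten, then both sides vanish: \<open>M d c e = 0\<close> and \<open>K c e f g = 0\<close>.\<close>
    also have "\<dots> = (\<Sum>d\<in>UNIV. \<Sum>c\<in>UNIV. \<Sum>e\<in>UNIV. \<Sum>f\<in>UNIV. \<Sum>g\<in>UNIV. (M d c e * K c e f g) \<cdot> F d f g)"
    proof (intro sum.cong refl)
      fix d c e
      show "M d c e \<cdot> act u d (mul e (act w c y) z) = (\<Sum>f\<in>UNIV. \<Sum>g\<in>UNIV. (M d c e * K c e f g) \<cdot> F d f g)"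
      proof (cases "lead c e")
        case True
        then show ?thesis
          by (simp add: Node.IH(2) F_def linear_pm_sum[OF linear_act] linear_pm_scale[OF linear_act]
              pm.scale_sum_right)
      next
        case False
        then show ?thesis
          using stuck[OF True Node.prems False] by (simp add: M_def)
      qed
    qed
    also have "\<dots> = (\<Sum>d\<in>UNIV. \<Sum>f\<in>UNIV. \<Sum>g\<in>UNIV. (\<Sum>c\<in>UNIV. \<Sum>e\<in>UNIV. M d c e * K c e f g) \<cdot> F d f g)"
      unfolding pm.scale_sum_left by (intro sum.cong[OF refl] sum_swap_pairs)
    also have "\<dots> = (\<Sum>d\<in>UNIV. \<Sum>f\<in>UNIV. \<Sum>g\<in>UNIV. (\<Sum>b\<in>UNIV. K a p b g * K q b d f) \<cdot> F d f g)"
      unfolding M_def confluent[OF True Node.prems] ..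
    also have "\<dots> = (\<Sum>b\<in>UNIV. \<Sum>g\<in>UNIV. K a p b g \<cdot> (\<Sum>d\<in>UNIV. \<Sum>f\<in>UNIV. K q b d f \<cdot> F d f g))"
      unfolding pm.scale_sum_left pm.scale_sum_right pm.scale_scale
      by (subst sum_swap_pairs) (rule sum.swap)
    also have "\<dots> = (\<Sum>b\<in>UNIV. \<Sum>g\<in>UNIV. K a p b g \<cdot> act \<langle>u, q, w\<rangle> b (mul g y z))"
    proof (intro sum.cong refl)
      fix b g
      show "K a p b g \<cdot> (\<Sum>d\<in>UNIV. \<Sum>f\<in>UNIV. K q b d f \<cdot> F d f g) = K a p b g \<cdot> act \<langle>u, q, w\<rangle> b (mul g y z)"
        using second_lead[OF True Node.prems] by (cases "K a p b g = 0") (auto simp: F_def)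
    qed
    finally show ?thesis .
  qed
qed

end

definition pair_lead :: "('a \<Rightarrow> 'a \<Rightarrow> bool) \<Rightarrow> ('b \<Rightarrow> 'b \<Rightarrow> bool) \<Rightarrow> 'a \<times> 'b \<Rightarrow> 'a \<times> 'b \<Rightarrow> bool" where
  "pair_lead lead lead' q p \<longleftrightarrow> lead (fst q) (fst p) \<and> lead' (snd q) (snd p)"

definition pair_coeff :: "('a \<Rightarrow> 'a \<Rightarrow> 'a \<Rightarrow> 'a \<Rightarrow> 'k::field) \<Rightarrow> ('b \<Rightarrow> 'b \<Rightarrow> 'b \<Rightarrow> 'b \<Rightarrow> 'k) \<Rightarrow>
    'a \<times> 'b \<Rightarrow> 'a \<times> 'b \<Rightarrow> 'a \<times> 'b \<Rightarrow> 'a \<times> 'b \<Rightarrow> 'k" where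
  "pair_coeff K K' a p b c = K (fst a) (fst p) (fst b) (fst c) * K' (snd a) (snd p) (snd b) (snd c)"

lemma sum_UNIV_pair_mult:
  fixes f :: "'a::finite \<Rightarrow> 'k::field" and g :: "'b::finite \<Rightarrow> 'k"
  shows "(\<Sum>x\<in>UNIV. f (fst x) * g (snd x)) = (\<Sum>x\<in>UNIV. f x) * (\<Sum>y\<in>UNIV. g y)"
  by (simp add: sum_product sum.cartesian_product split_def flip: UNIV_Times_UNIV)

text \<open>A left comb with pairs of operations can be rewritten if and only if both components can, and the
  rules are the products of the component rules. Hence each sum in the axioms is a product of two
  sums of the same kind; in \<open>stuck\<close> one of the two factors vanishes.\<close>

lemma left_comb_rewriting_pair:
  fixes lead :: "'a::finite \<Rightarrow> 'a \<Rightarrow> bool" and lead' :: "'b::finite \<Rightarrow> 'b \<Rightarrow> bool"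
    and K :: "'a \<Rightarrow> 'a \<Rightarrow> 'a \<Rightarrow> 'a \<Rightarrow> 'k::field" and K' :: "'b \<Rightarrow> 'b \<Rightarrow> 'b \<Rightarrow> 'b \<Rightarrow> 'k"
  assumes "left_comb_rewriting lead K" and "left_comb_rewriting lead' K'"
  shows "left_comb_rewriting (pair_lead lead lead') (pair_coeff K K')"
proof -
  interpret A: left_comb_rewriting lead K by (rule assms)
  interpret B: left_comb_rewriting lead' K' by (rule assms)
  have *: "(\<Sum>b\<in>UNIV. pair_coeff K K' q a b c * pair_coeff K K' b p d e) =
      (\<Sum>b\<in>UNIV. K (fst q) (fst a) b (fst c) * K b (fst p) (fst d) (fst e)) *
      (\<Sum>b\<in>UNIV. K' (snd q) (snd a) b (snd c) * K' b (snd p) (snd d) (snd e))"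
    for q a c p d e :: "'a \<times> 'b"
    by (simp add: pair_coeff_def mult_ac flip: sum_UNIV_pair_mult)
  show ?thesis
  proof
    fix q a p c e d :: "'a \<times> 'b"
    assume "pair_lead lead lead' q a" "pair_lead lead lead' a p" "\<not> pair_lead lead lead' c e"
    then show "(\<Sum>b\<in>UNIV. pair_coeff K K' q a b c * pair_coeff K K' b p d e) = 0"
      unfolding * by (auto simp: pair_lead_def A.stuck B.stuck)
  next
    fix q a p d f g :: "'a \<times> 'b"
    assume l: "pair_lead lead lead' q a" "pair_lead lead lead' a p"
    define M where "M c e = (\<Sum>b\<in>UNIV. K (fst q) (fst a) b c * K b (fst p) (fst d) e)" for c e
    define M' where "M' c e = (\<Sum>b\<in>UNIV. K' (snd q) (snd a) b c * K' b (snd p) (snd d) e)" for c e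
    have "(\<Sum>c\<in>UNIV. \<Sum>e\<in>UNIV.
        (\<Sum>b\<in>UNIV. pair_coeff K K' q a b c * pair_coeff K K' b p d e) * pair_coeff K K' c e f g) =
        (\<Sum>c\<in>UNIV. \<Sum>e\<in>UNIV. (M (fst c) (fst e) * K (fst c) (fst e) (fst f) (fst g)) *
          (M' (snd c) (snd e) * K' (snd c) (snd e) (snd f) (snd g)))"
      unfolding * by (simp add: M_def M'_def pair_coeff_def mult_ac)
    also have "\<dots> = (\<Sum>c\<in>UNIV. \<Sum>e\<in>UNIV. M c e * K c e (fst f) (fst g)) *
        (\<Sum>c\<in>UNIV. \<Sum>e\<in>UNIV. M' c e * K' c e (snd f) (snd g))"
      unfolding sum_UNIV_pair_mult[of "\<lambda>e. M (fst c) e * K (fst c) e (fst f) (fst g)"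
          "\<lambda>e. M' (snd c) e * K' (snd c) e (snd f) (snd g)" for c]
      by (rule sum_UNIV_pair_mult)
    also have "\<dots> = (\<Sum>b\<in>UNIV. K (fst a) (fst p) b (fst g) * K (fst q) b (fst d) (fst f)) *
        (\<Sum>b\<in>UNIV. K' (snd a) (snd p) b (snd g) * K' (snd q) b (snd d) (snd f))"
      using l unfolding M_def M'_def pair_lead_def by (simp add: A.confluent B.confluent)
    also have "\<dots> = (\<Sum>b\<in>UNIV. pair_coeff K K' a p b g * pair_coeff K K' q b d f)"
      by (simp add: pair_coeff_def mult_ac flip: sum_UNIV_pair_mult)
    finally show "(\<Sum>c\<in>UNIV. \<Sum>e\<in>UNIV.
        (\<Sum>b\<in>UNIV. pair_coeff K K' q a b c * pair_coeff K K' b p d e) * pair_coeff K K' c e f g) =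
        (\<Sum>b\<in>UNIV. pair_coeff K K' a p b g * pair_coeff K K' q b d f)" .
  qed (auto simp: pair_lead_def pair_coeff_def dest: A.coeff_lead B.coeff_lead
      intro: A.first_lead B.first_lead A.second_lead B.second_lead)
qed

text \<open>The normal forms of the rewriting.\<close>

fun reduced :: "('o \<Rightarrow> 'o \<Rightarrow> bool) \<Rightarrow> 'o tree \<Rightarrow> bool" where
  "reduced lead \<langle>\<rangle> = True"
| "reduced lead \<langle>l, p, r\<rangle> =
    (reduced lead l \<and> reduced lead r \<and> (case l of \<langle>\<rangle> \<Rightarrow> True | \<langle>_, q, _\<rangle> \<Rightarrow> \<not> lead q p))"

context left_comb_rewriting
begin

lemma mul_mul:
  assumes "lead a p"
  shows "mul p (mul a x y) z = (\<Sum>b\<in>UNIV. \<Sum>c\<in>UNIV. K a p b c \<cdot> mul b x (mul c y z))"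
proof (rule linear_pm_eqI[where p = x])
  show "linear_pm (\<lambda>x. mul p (mul a x y) z)"
    by (rule linear_pm_comp[OF linear_mul(1) linear_mul(1)])
  show "linear_pm (\<lambda>x. \<Sum>b\<in>UNIV. \<Sum>c\<in>UNIV. K a p b c \<cdot> mul b x (mul c y z))"
    by (intro linear_pm_summed linear_pm_scaled linear_mul)
qed (use mul_act[OF assms] in simp)

lemma act_irreducible:
  "(\<And>u q w. t = \<langle>u, q, w\<rangle> \<Longrightarrow> \<not> lead q p) \<Longrightarrow> act t p z = lin_map (\<lambda>s. basis_vec \<langle>t, p, s\<rangle>) z"
  by (cases t) auto

lemma keys_act:
  assumes "reduced lead t" "\<forall>s\<in>Poly_Mapping.keys z. reduced lead s \<and> size1 s = n"
  shows "\<forall>s\<in>Poly_Mapping.keys (act t p z). reduced lead s \<and> size1 s = size1 t + n"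
  using assms
proof (induction t arbitrary: p z n)
  case Leaf
  then show ?case using keys_lin_map[of "\<lambda>s. basis_vec \<langle>\<langle>\<rangle>, p, s\<rangle>" z] by fastforce
next
  case (Node u q w)
  show ?case
  proof (cases "lead q p")
    case True
    show ?thesis
    proof
      fix s assume "s \<in> Poly_Mapping.keys (act \<langle>u, q, w\<rangle> p z)"
      then have "\<exists>b c. s \<in> Poly_Mapping.keys (K q p b c \<cdot> act u b (act w c z))"
        using True by (fastforce dest!: subsetD[OF keys_sum])
      then obtain b c where s: "s \<in> Poly_Mapping.keys (act u b (act w c z))"
        by (auto simp: in_keys_iff lookup_map_mult)
      have "\<forall>s\<in>Poly_Mapping.keys (act w c z). reduced lead s \<and> size1 s = size1 w + n"
        by (rule Node.IH(2)[OF _ Node.prems(2)]) (use Node.prems(1) in simp)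
      then have "reduced lead s \<and> size1 s = size1 u + (size1 w + n)"
        by (intro bspec[OF Node.IH(1) s]) (use Node.prems(1) in simp)
      then show "reduced lead s \<and> size1 s = size1 \<langle>u, q, w\<rangle> + n" by simp
    qed
  next
    case False
    then show ?thesis
      using keys_lin_map[of "\<lambda>s. basis_vec \<langle>\<langle>u, q, w\<rangle>, p, s\<rangle>" z] Node.prems by fastforce
  qed
qed

lemma keys_mul:
  assumes "\<forall>t\<in>Poly_Mapping.keys x. reduced lead t \<and> size1 t = m"
    and "\<forall>s\<in>Poly_Mapping.keys z. reduced lead s \<and> size1 s = n"
  shows "\<forall>s\<in>Poly_Mapping.keys (mul p x z). reduced lead s \<and> size1 s = m + n"
proof
  fix s assume "s \<in> Poly_Mapping.keys (mul p x z)"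
  then obtain t where "t \<in> Poly_Mapping.keys x" "s \<in> Poly_Mapping.keys (act t p z)"
    unfolding mul_def using keys_lin_map[of "\<lambda>t. act t p z" x] by auto
  then show "reduced lead s \<and> size1 s = m + n"
    using keys_act[OF _ assms(2), of t p] bspec[OF assms(1), of t] by simp
qed

end

section \<open>The rewriting systems of Dend and Quad\<close>

text \<open>\<open>Half\<close> is the dendriform operation \<open>\<prec>\<close> and \<open>Full\<close> is the associative operation
  \<open>* = \<prec> + \<succ>\<close>.\<close>

datatype half_op = Half | Full

lemma UNIV_half_op: "UNIV = {Half, Full}"
  using half_op.exhaust by auto

instance half_op :: finite
  by standard (simp add: UNIV_half_op)

definition dend_lead :: "half_op \<Rightarrow> half_op \<Rightarrow> bool" where
  "dend_lead q p \<longleftrightarrow> \<not> (q = Half \<and> p = Full)"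

text \<open>The coefficients of the three rules for \<open>(x \<prec> y) \<prec> z\<close>, \<open>(x * y) \<prec> z\<close> and \<open>(x * y) * z\<close>.\<close>

fun dend_coeff :: "half_op \<Rightarrow> half_op \<Rightarrow> half_op \<Rightarrow> half_op \<Rightarrow> 'k::field" where
  "dend_coeff Half Half Half Full = 1"
| "dend_coeff Full Half Half Full = 1"
| "dend_coeff Full Half Full Half = 1"
| "dend_coeff Full Half Half Half = -1"
| "dend_coeff Full Full Full Full = 1"
| "dend_coeff _ _ _ _ = 0"

text \<open>The left combs with three nodes in which both pairs can be rewritten have the operations
  \<open>\<prec>\<prec>\<prec>\<close>, \<open>*\<prec>\<prec>\<close>, \<open>**\<prec>\<close>, \<open>***\<close>, from the inside to the outside. In each of these cases both ways of
  rewriting are computed.\<close>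

lemma left_comb_rewriting_dend: "left_comb_rewriting dend_lead dend_coeff"
proof
  fix q a p d f g
  show "(\<Sum>c\<in>UNIV. \<Sum>e\<in>UNIV. (\<Sum>b\<in>UNIV. dend_coeff q a b c * dend_coeff b p d e) * dend_coeff c e f g) =
        (\<Sum>b\<in>UNIV. dend_coeff a p b g * dend_coeff q b d f)" if "dend_lead q a" "dend_lead a p"
    using that by (cases q; cases a; cases p; cases d; cases f; cases g; simp add: UNIV_half_op dend_lead_def)
next
  fix q a p c e d
  show "(\<Sum>b\<in>UNIV. dend_coeff q a b c * dend_coeff b p d e) = 0"
    if "dend_lead q a" "dend_lead a p" "\<not> dend_lead c e"
    using that by (cases q; cases a; cases p; cases d; simp add: UNIV_half_op dend_lead_def)
next
  fix a p b c
  show "dend_lead a p" if "dend_coeff a p b c \<noteq> 0"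
    using that by (cases a; cases p; simp add: dend_lead_def)
next
  fix q a p b c
  show "dend_lead b p" if "dend_lead q a" "dend_lead a p" "dend_coeff q a b c \<noteq> 0"
    using that by (cases q; cases a; cases p; cases b; cases c; simp add: dend_lead_def)
  show "dend_lead q b" if "dend_lead q a" "dend_lead a p" "dend_coeff a p b c \<noteq> 0"
    using that by (cases q; cases a; cases p; cases b; cases c; simp add: dend_lead_def)
qed

abbreviation quad_lead :: "half_op \<times> half_op \<Rightarrow> half_op \<times> half_op \<Rightarrow> bool" where
  "quad_lead \<equiv> pair_lead dend_lead dend_lead"

section \<open>Counting reduced trees\<close>

lemma all_half_op: "(\<forall>p. P p) \<longleftrightarrow> P Half \<and> P Full"
  by (metis half_op.exhaust)

lemma finite_trees_of_size: "finite {t :: 'o::finite tree. size1 t = n}"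
proof (induction n rule: less_induct)
  case (less n)
  have "{t :: 'o tree. size1 t = n} \<subseteq> insert \<langle>\<rangle> (\<Union>m<n. \<Union>k<n.
      (\<lambda>(l, p, r). \<langle>l, p, r\<rangle>) ` ({t. size1 t = m} \<times> UNIV \<times> {t. size1 t = k}))"
  proof
    fix t :: "'o tree" assume t: "t \<in> {t. size1 t = n}"
    show "t \<in> insert \<langle>\<rangle> (\<Union>m<n. \<Union>k<n.
      (\<lambda>(l, p, r). \<langle>l, p, r\<rangle>) ` ({t. size1 t = m} \<times> UNIV \<times> {t. size1 t = k}))"
    proof (cases t)
      case (Node l p r)
      then have "size1 l < n" "size1 r < n" using t by auto
      then show ?thesis using Node by force
    qed simp
  qed
  moreover have "finite (insert \<langle>\<rangle> (\<Union>m<n. \<Union>k<n.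
      (\<lambda>(l, p, r). \<langle>l, p, r\<rangle>) ` ({t :: 'o tree. size1 t = m} \<times> (UNIV :: 'o set) \<times> {t. size1 t = k})))"
    using less by simp
  ultimately show ?case by (rule finite_subset)
qed

definition arity_gf :: "'o tree set \<Rightarrow> real fps" where
  "arity_gf C = Abs_fps (\<lambda>n. real (card {t \<in> C. size1 t = n}))"

lemma arity_gf_leaf: "arity_gf {\<langle>\<rangle> :: 'o tree} = fps_X"
proof -
  have "card {t \<in> {\<langle>\<rangle> :: 'o tree}. size1 t = n} = (if n = 1 then 1 else 0)" for n
    by (cases "n = 1") (auto simp: card_1_singleton_iff)
  then show ?thesis by (simp add: arity_gf_def fps_eq_iff del: singleton_iff)
qed

lemma arity_gf_Un:
  fixes C D :: "'o::finite tree set"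
  assumes "C \<inter> D = {}"
  shows "arity_gf (C \<union> D) = arity_gf C + arity_gf D"
proof -
  have "card {t \<in> C \<union> D. size1 t = n} = card {t \<in> C. size1 t = n} + card {t \<in> D. size1 t = n}" for n
  proof -
    have "{t \<in> C \<union> D. size1 t = n} = {t \<in> C. size1 t = n} \<union> {t \<in> D. size1 t = n}" by auto
    then show ?thesis
      using assms
      by (simp add: card_Un_disjoint finite_subset[OF _ finite_trees_of_size[of n]] disjoint_iff subset_iff)
  qed
  then show ?thesis by (simp add: arity_gf_def fps_eq_iff)
qed

lemma arity_gf_Node:
  fixes C D :: "'o::finite tree set"
  shows "arity_gf {\<langle>l, p, r\<rangle> | l r. l \<in> C \<and> r \<in> D} = arity_gf C * arity_gf D"
proof (rule fps_ext)
  fix n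
  let ?A = "\<lambda>m. {t \<in> C. size1 t = m}" and ?B = "\<lambda>m. {t \<in> D. size1 t = m}"
  have fin: "finite (?A m)" "finite (?B m)" for m
    by (auto intro: finite_subset[OF _ finite_trees_of_size])
  have "{t \<in> {\<langle>l, p, r\<rangle> | l r. l \<in> C \<and> r \<in> D}. size1 t = n} =
      (\<Union>m\<in>{0..n}. (\<lambda>(l, r). \<langle>l, p, r\<rangle>) ` (?A m \<times> ?B (n - m)))"
    by (force simp: image_iff)
  also have "card \<dots> = (\<Sum>m=0..n. card ((\<lambda>(l, r). \<langle>l, p, r\<rangle>) ` (?A m \<times> ?B (n - m))))"
    using fin by (intro card_UN_disjoint) auto
  also have "\<dots> = (\<Sum>m=0..n. card (?A m) * card (?B (n - m)))"
    by (intro sum.cong refl) (subst card_image; auto simp: inj_on_def card_cartesian_product)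
  finally show "arity_gf {\<langle>l, p, r\<rangle> | l r. l \<in> C \<and> r \<in> D} $ n = (arity_gf C * arity_gf D) $ n"
    by (simp add: arity_gf_def fps_mult_nth)
qed

lemma arity_gf_Union:
  fixes C :: "'i \<Rightarrow> 'o::finite tree set"
  assumes "finite I" and "\<And>i j. i \<in> I \<Longrightarrow> j \<in> I \<Longrightarrow> i \<noteq> j \<Longrightarrow> C i \<inter> C j = {}"
  shows "arity_gf (\<Union>i\<in>I. C i) = (\<Sum>i\<in>I. arity_gf (C i))"
  using assms
proof (induction I)
  case (insert i I)
  then have "C i \<inter> (\<Union>j\<in>I. C j) = {}" by blast
  with insert show ?case by (simp add: arity_gf_Un)
qed (simp add: arity_gf_def fps_eq_iff)

definition reduced_root :: "('o \<Rightarrow> 'o \<Rightarrow> bool) \<Rightarrow> 'o \<Rightarrow> 'o tree set" where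
  "reduced_root lead p = {\<langle>l, p, r\<rangle> | l r. reduced lead \<langle>l, p, r\<rangle>}"

lemma Node_in_reduced_root [simp]:
  "\<langle>l, p', r\<rangle> \<in> reduced_root lead p \<longleftrightarrow> p' = p \<and> reduced lead \<langle>l, p, r\<rangle>"
  by (auto simp: reduced_root_def)

lemma Leaf_notin_reduced_root [simp]: "\<langle>\<rangle> \<notin> reduced_root lead p"
  by (simp add: reduced_root_def)

lemma arity_gf_leaf_or_root:
  fixes lead :: "'o::finite \<Rightarrow> 'o \<Rightarrow> bool"
  shows "arity_gf ({\<langle>\<rangle>} \<union> (\<Union>q\<in>Q. reduced_root lead q)) =
    fps_X + (\<Sum>q\<in>Q. arity_gf (reduced_root lead q))"
proof -
  have "{\<langle>\<rangle>} \<inter> (\<Union>q\<in>Q. reduced_root lead q) = {}" by (auto simp: reduced_root_def)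
  moreover have "arity_gf (\<Union>q\<in>Q. reduced_root lead q) = (\<Sum>q\<in>Q. arity_gf (reduced_root lead q))"
    by (intro arity_gf_Union) (auto simp: reduced_root_def)
  ultimately show ?thesis by (simp only: arity_gf_Un arity_gf_leaf)
qed

text \<open>A reduced tree with root \<open>p\<close> has an arbitrary reduced tree on the right, and on the left a leaf or a
  reduced tree whose root cannot be rewritten together with \<open>p\<close>.\<close>

lemma arity_gf_reduced_root:
  fixes lead :: "'o::finite \<Rightarrow> 'o \<Rightarrow> bool"
  shows "arity_gf (reduced_root lead p) =
    (fps_X + (\<Sum>q | \<not> lead q p. arity_gf (reduced_root lead q))) * arity_gf {t. reduced lead t}"
proof -
  let ?C = "{\<langle>\<rangle>} \<union> (\<Union>q\<in>{q. \<not> lead q p}. reduced_root lead q)"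
  have "t \<in> reduced_root lead p \<longleftrightarrow> t \<in> {\<langle>l, p, r\<rangle> | l r. l \<in> ?C \<and> r \<in> {t. reduced lead t}}" for t
  proof (cases t)
    case (Node l p' r)
    show ?thesis unfolding Node
      by (cases l; simp) (rule iffI; elim conjE; intro conjI; assumption)
  qed simp
  then have "reduced_root lead p = {\<langle>l, p, r\<rangle> | l r. l \<in> ?C \<and> r \<in> {t. reduced lead t}}"
    by (rule Set.set_eqI)
  then show ?thesis by (simp only: arity_gf_Node arity_gf_leaf_or_root)
qed

lemma arity_gf_reduced:
  fixes lead :: "'o::finite \<Rightarrow> 'o \<Rightarrow> bool"
  shows "arity_gf {t. reduced lead t} = fps_X + (\<Sum>q\<in>UNIV. arity_gf (reduced_root lead q))"
proof -
  have "{t. reduced lead t} = {\<langle>\<rangle>} \<union> (\<Union>q\<in>UNIV. reduced_root lead q)"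
  proof (rule Set.set_eqI)
    fix t show "t \<in> {t. reduced lead t} \<longleftrightarrow> t \<in> {\<langle>\<rangle>} \<union> (\<Union>q\<in>UNIV. reduced_root lead q)"
      by (cases t) simp_all
  qed
  then show ?thesis by (simp only: arity_gf_leaf_or_root)
qed

lemma UNIV_half_op_pair: "UNIV = {(Half, Half), (Half, Full), (Full, Half), (Full, Full)}"
  by (simp add: set_eq_iff all_half_op)

text \<open>The decomposition at the root gives an equation for each of the series \<open>a\<close>, \<open>b\<close>, \<open>c\<close>, \<open>d\<close> of
  the reduced trees with a given root. They determine these series in terms of \<open>T\<close>: one finds
  \<open>b = c\<close>, \<open>b (1 - T) = X T (1 + T)\<close> and \<open>d (1 + T) = T\<^sup>2\<close>. Substitution into
  \<open>T = X + a + b + c + d\<close> gives the equation for \<open>T\<close>.\<close>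

lemma arity_gf_reduced_quad:
  "arity_gf {t. reduced quad_lead t} * (1 - arity_gf {t. reduced quad_lead t}) =
    fps_X * (1 + arity_gf {t. reduced quad_lead t}) ^ 3"
proof -
  define T where "T = arity_gf {t. reduced quad_lead t}"
  define a b c d where "a = arity_gf (reduced_root quad_lead (Half, Half))"
    and "b = arity_gf (reduced_root quad_lead (Half, Full))"
    and "c = arity_gf (reduced_root quad_lead (Full, Half))"
    and "d = arity_gf (reduced_root quad_lead (Full, Full))"
  note defs = T_def a_def b_def c_def d_def
  have left: "{q. \<not> quad_lead q (Half, Half)} = {}"
    "{q. \<not> quad_lead q (Half, Full)} = {(Half, Half), (Full, Half)}"
    "{q. \<not> quad_lead q (Full, Half)} = {(Half, Half), (Half, Full)}"
    "{q. \<not> quad_lead q (Full, Full)} = {(Half, Half), (Half, Full), (Full, Half)}"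
    by (simp_all add: set_eq_iff all_half_op pair_lead_def dend_lead_def)
  have T: "T = fps_X + a + b + c + d"
    unfolding defs by (subst arity_gf_reduced) (simp add: UNIV_half_op_pair algebra_simps)
  have a: "a = fps_X * T" and b: "b = (fps_X + a + c) * T" and c: "c = (fps_X + a + b) * T"
    and d: "d = (fps_X + a + b + c) * T"
    unfolding defs by (subst arity_gf_reduced_root, simp add: left algebra_simps)+
  have T0: "T $ 0 = 0" unfolding T_def arity_gf_def by (simp add: size1_size)
  \<comment> \<open>The symmetry that exchanges the two factors of the black square product.\<close>
  have "(b - c) * (1 + T) = 0" using b c by (simp add: algebra_simps)
  moreover have "(1 + T) $ 0 \<noteq> 0" using T0 by simp
  then have "1 + T \<noteq> 0" by force
  ultimately have bc: "b = c" by simp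
  have b': "b * (1 - T) = fps_X * T * (1 + T)" using a b bc by (simp add: algebra_simps)
  have d': "d * (1 + T) = T * T"
  proof -
    have "fps_X + a + b + c = T - d" by (simp add: T)
    then have "d = (T - d) * T" by (subst d) simp
    then show ?thesis by (simp add: algebra_simps)
  qed
  have "T * (1 - T) * (1 + T) = (fps_X + a + 2 * b + d) * (1 - T) * (1 + T)"
    by (subst (1) T) (simp add: bc)
  also have "\<dots> = fps_X * (1 + T) * (1 - T) * (1 + T) + 2 * (b * (1 - T)) * (1 + T) + d * (1 + T) * (1 - T)"
    by (simp add: a algebra_simps)
  also have "\<dots> = fps_X * (1 + T) ^ 3 + T * T * (1 - T)"
    unfolding b' d' by (simp add: algebra_simps power3_eq_cube)
  finally show ?thesis unfolding T_def[symmetric] by (simp add: algebra_simps)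
qed

theorem card_reduced_quad:
  assumes "n > 0"
  shows "real n * real (card {t. size1 t = n \<and> reduced quad_lead t}) =
    (\<Sum>j = n..2 * n - 1. real (((3 * n) choose (n + 1 + j)) * ((j - 1) choose (j - n))))"
proof -
  have "arity_gf {t. reduced quad_lead t} $ 0 = 0" by (simp add: arity_gf_def size1_size)
  from coeff_of_quad_functional_equation[OF arity_gf_reduced_quad this assms] show ?thesis
    by (simp add: arity_gf_def conj_commute)
qed

section \<open>Ideals of the free operad\<close>

definition homogeneous :: "nat \<Rightarrow> ('b tree \<Rightarrow>\<^sub>0 'k::field) \<Rightarrow> bool" where
  "homogeneous n p \<longleftrightarrow> (\<forall>t\<in>Poly_Mapping.keys p. size1 t = n)"

lemma carrier_free_operad: "p \<in> carrier (component free_operad n) \<longleftrightarrow> homogeneous n p"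
  by (auto simp: free_operad_def free_vs_def homogeneous_def)

lemma homogeneous_basis [simp]: "homogeneous n (basis_vec t) \<longleftrightarrow> size1 t = n"
  by (simp add: homogeneous_def)

lemma homogeneous_zero [simp]: "homogeneous n 0"
  by (simp add: homogeneous_def)

lemma homogeneous_add: "homogeneous n p \<Longrightarrow> homogeneous n q \<Longrightarrow> homogeneous n (p + q)"
  using Poly_Mapping.keys_add[of p q] by (auto simp: homogeneous_def)

lemma homogeneous_scale: "homogeneous n p \<Longrightarrow> homogeneous n (c \<cdot> p)"
  by (auto simp: homogeneous_def in_keys_iff lookup_map_mult)

lemma homogeneous_sum: "(\<And>i. i \<in> I \<Longrightarrow> homogeneous n (p i)) \<Longrightarrow> homogeneous n (\<Sum>i\<in>I. p i)"
  by (induction I rule: infinite_finite_induct) (simp_all add: homogeneous_add)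

lemma homogeneous_lin_map:
  "(\<And>x. x \<in> Poly_Mapping.keys p \<Longrightarrow> homogeneous n (f x)) \<Longrightarrow> homogeneous n (lin_map f p)"
  unfolding lin_map_def by (intro homogeneous_sum homogeneous_scale)

lemma partial_comp_free_operad_eq:
  "partial_comp free_operad m n i p q = lin_map (\<lambda>t. lin_map (\<lambda>s. basis_vec (graft t i s)) q) p"
  by (simp add: free_operad_def lin_ext_eq_lin_map tensor_eq_lin_map lin_map_lin_map)

definition node :: "'b \<Rightarrow> ('b tree \<Rightarrow>\<^sub>0 'k::field) \<Rightarrow> ('b tree \<Rightarrow>\<^sub>0 'k) \<Rightarrow> ('b tree \<Rightarrow>\<^sub>0 'k)" where
  "node a x y = lin_map (\<lambda>l. lin_map (\<lambda>r. basis_vec \<langle>l, a, r\<rangle>) y) x"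

lemma linear_node: "linear_pm (\<lambda>x. node a x y)" "linear_pm (node a x)"
  unfolding node_def by (intro linear_lin_map linear_lin_map_family)+

lemma node_basis [simp]: "node a (basis_vec l) (basis_vec r) = basis_vec \<langle>l, a, r\<rangle>"
  by (simp add: node_def)

lemma homogeneous_node: "homogeneous m x \<Longrightarrow> homogeneous n y \<Longrightarrow> homogeneous (m + n) (node a x y)"
  unfolding node_def by (intro homogeneous_lin_map) (simp add: homogeneous_def)

abbreviation ideal :: "('b, 'k::field) relation set \<Rightarrow> nat \<Rightarrow> ('b tree \<Rightarrow>\<^sub>0 'k) set" where
  "ideal \<Lambda> \<equiv> generated_ideal free_operad (relators \<Lambda>)"

lemma ideal_homogeneous: "p \<in> ideal \<Lambda> n \<Longrightarrow> homogeneous n p"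
  using submodule.subset[OF submodule_generated_ideal[OF relators_subset]]
  by (force simp flip: carrier_free_operad)

lemma ideal_zero: "0 \<in> ideal \<Lambda> n"
  using in_generated_ideal.zero[of free_operad "relators \<Lambda>" n]
  by (simp add: generated_ideal_def free_operad_def free_vs_def)

lemma ideal_add: "p \<in> ideal \<Lambda> n \<Longrightarrow> q \<in> ideal \<Lambda> n \<Longrightarrow> p + q \<in> ideal \<Lambda> n"
  using in_generated_ideal.add[of free_operad "relators \<Lambda>" n p q]
  by (simp add: generated_ideal_def free_operad_def free_vs_def)

lemma ideal_scale: "p \<in> ideal \<Lambda> n \<Longrightarrow> c \<cdot> p \<in> ideal \<Lambda> n"
  using in_generated_ideal.smult[of free_operad "relators \<Lambda>" n p c]
  by (simp add: generated_ideal_def free_operad_def free_vs_def)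

lemma ideal_sum: "(\<And>i. i \<in> I \<Longrightarrow> p i \<in> ideal \<Lambda> n) \<Longrightarrow> (\<Sum>i\<in>I. p i) \<in> ideal \<Lambda> n"
  by (induction I rule: infinite_finite_induct) (simp_all add: ideal_zero ideal_add)

lemma ideal_diff: "p \<in> ideal \<Lambda> n \<Longrightarrow> q \<in> ideal \<Lambda> n \<Longrightarrow> p - q \<in> ideal \<Lambda> n"
  using ideal_add[of p \<Lambda> n "-1 \<cdot> q"] ideal_scale[of q \<Lambda> n "-1"] by (simp only: pm.scale_minus_left) simp

lemma ideal_refl: "p - p \<in> ideal \<Lambda> n"
  by (simp add: ideal_zero)

lemma ideal_sym: "p - q \<in> ideal \<Lambda> n \<Longrightarrow> q - p \<in> ideal \<Lambda> n"
  using ideal_diff[OF ideal_zero, of "p - q"] by simp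

lemma ideal_trans: "p - q \<in> ideal \<Lambda> n \<Longrightarrow> q - r \<in> ideal \<Lambda> n \<Longrightarrow> p - r \<in> ideal \<Lambda> n"
  using ideal_add[of "p - q" \<Lambda> n "q - r"] by simp

lemma ideal_partial_comp_left:
  "x \<in> ideal \<Lambda> m \<Longrightarrow> homogeneous n y \<Longrightarrow> 1 \<le> i \<Longrightarrow> i \<le> m \<Longrightarrow>
    lin_map (\<lambda>t. lin_map (\<lambda>s. basis_vec (graft t i s)) y) x \<in> ideal \<Lambda> (m + n - 1)"
  using in_generated_ideal.compose_left[of free_operad "relators \<Lambda>" m x y n i]
  by (simp add: generated_ideal_def carrier_free_operad partial_comp_free_operad_eq)

lemma ideal_partial_comp_right:
  "homogeneous m x \<Longrightarrow> y \<in> ideal \<Lambda> n \<Longrightarrow> 1 \<le> i \<Longrightarrow> i \<le> m \<Longrightarrow>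
    lin_map (\<lambda>t. lin_map (\<lambda>s. basis_vec (graft t i s)) y) x \<in> ideal \<Lambda> (m + n - 1)"
  using in_generated_ideal.compose_right[of x free_operad m "relators \<Lambda>" n y i]
  by (simp add: generated_ideal_def carrier_free_operad partial_comp_free_operad_eq)

text \<open>Grafting \<open>x\<close> at the first input of \<open>node a \<langle>\<rangle> y\<close> gives \<open>node a x y\<close>, and likewise
  grafting \<open>y\<close> at the last input of \<open>node a x \<langle>\<rangle>\<close>; so closure of the ideal under partial
  composition gives closure under \<open>node\<close>.\<close>

lemma ideal_node_left:
  assumes "x \<in> ideal \<Lambda> m" "homogeneous n y"
  shows "node a x y \<in> ideal \<Lambda> (m + n)"
proof -
  have "homogeneous (1 + n) (node a (basis_vec \<langle>\<rangle>) y)"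
    using assms by (intro homogeneous_node) simp_all
  from ideal_partial_comp_right[OF this assms(1), of 1] show ?thesis
    by (simp add: node_def lin_map_lin_map add.commute lin_map_swap[of _ x])
qed

lemma ideal_node_right:
  assumes "homogeneous m x" "y \<in> ideal \<Lambda> n"
  shows "node a x y \<in> ideal \<Lambda> (m + n)"
proof -
  have "homogeneous (m + 1) (node a x (basis_vec \<langle>\<rangle>))"
    using assms by (intro homogeneous_node) simp_all
  from ideal_partial_comp_right[OF this assms(2), of "m + 1"]
  have "lin_map (\<lambda>l. lin_map (\<lambda>s. basis_vec (graft \<langle>l, a, \<langle>\<rangle>\<rangle> (m + 1) s)) y) x \<in> ideal \<Lambda> (m + n)"
    by (simp add: node_def lin_map_lin_map)
  also have "lin_map (\<lambda>l. lin_map (\<lambda>s. basis_vec (graft \<langle>l, a, \<langle>\<rangle>\<rangle> (m + 1) s)) y) x = node a x y"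
    using assms(1) unfolding node_def homogeneous_def by (intro lin_map_cong) simp
  finally show ?thesis .
qed

lemma ideal_node_cong:
  assumes "x - x' \<in> ideal \<Lambda> m" "y - y' \<in> ideal \<Lambda> n" "homogeneous m x'" "homogeneous n y"
  shows "node a x y - node a x' y' \<in> ideal \<Lambda> (m + n)"
proof (rule ideal_trans)
  show "node a x y - node a x' y \<in> ideal \<Lambda> (m + n)"
    using ideal_node_left[OF assms(1,4), of a] by (simp add: linear_pm_diff[OF linear_node(1)])
  show "node a x' y - node a x' y' \<in> ideal \<Lambda> (m + n)"
    using ideal_node_right[OF assms(3,2), of a] by (simp add: linear_pm_diff[OF linear_node(2)])
qed

text \<open>Substitute \<open>z\<close>, \<open>y\<close>, \<open>x\<close> for the three inputs of a relator, in this order, so that the numbers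
  of the inputs still to be filled do not change.\<close>

lemma ideal_relation:
  assumes rel: "(u, v) \<in> \<Lambda>" and hom: "homogeneous k x" "homogeneous l y" "homogeneous m z"
  shows "lin_map (\<lambda>(a, b). node b (node a x y) z) u - lin_map (\<lambda>(a, b). node a x (node b y z)) v
    \<in> ideal \<Lambda> (k + l + m)"
proof -
  define G where "G i y p = lin_map (\<lambda>t. lin_map (\<lambda>s. basis_vec (graft t i s)) y) p"
    for i and y p :: "'a tree \<Rightarrow>\<^sub>0 'b"
  define P where "P p = G 1 x (G 2 y (G 3 z p))" for p
  have lin: "linear_pm P"
    unfolding P_def G_def by (intro linear_pm_comp[OF linear_lin_map] linear_lin_map)
  define r where "r = lin_ext (\<lambda>(a, b). \<langle>\<langle>\<langle>\<rangle>, a, \<langle>\<rangle>\<rangle>, b, \<langle>\<rangle>\<rangle>) u - lin_ext (\<lambda>(a, b). \<langle>\<langle>\<rangle>, a, \<langle>\<langle>\<rangle>, b, \<langle>\<rangle>\<rangle>\<rangle>) v"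
  have "r \<in> ideal \<Lambda> 3"
    using rel unfolding generated_ideal_def r_def
    by (intro CollectI in_generated_ideal.gen) (auto simp: relators_def)
  then have "G 3 z r \<in> ideal \<Lambda> (m + 2)"
    unfolding G_def using ideal_partial_comp_left[of r \<Lambda> 3 m z 3] hom by (simp add: add.commute)
  then have "G 2 y (G 3 z r) \<in> ideal \<Lambda> (l + m + 1)"
    unfolding G_def[of 2] using ideal_partial_comp_left[of "G 3 z r" \<Lambda> "m + 2" l y 2] hom
    by (simp add: add.commute)
  then have "P r \<in> ideal \<Lambda> (k + l + m)"
    unfolding P_def G_def[of 1] using ideal_partial_comp_left[of "G 2 y (G 3 z r)" \<Lambda> "l + m + 1" k x 1] hom
    by (simp add: ac_simps)
  moreover have "P (basis_vec \<langle>\<langle>\<langle>\<rangle>, a, \<langle>\<rangle>\<rangle>, b, \<langle>\<rangle>\<rangle>) = node b (node a x y) z" for a b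
    by (simp add: P_def G_def node_def lin_map_lin_map lin_map_swap[of _ z] lin_map_swap[of _ y x])
  moreover have "P (basis_vec \<langle>\<langle>\<rangle>, a, \<langle>\<langle>\<rangle>, b, \<langle>\<rangle>\<rangle>\<rangle>) = node a x (node b y z)" for a b
    by (simp add: P_def G_def node_def lin_map_lin_map lin_map_swap[of _ z] lin_map_swap[of _ y x])
  ultimately show ?thesis
    by (simp add: r_def linear_pm_diff[OF lin] lin_ext_eq_lin_map linear_pm_lin_map[OF lin] split_def)
qed

section \<open>Evaluating trees in an algebra\<close>

fun evaluate :: "('b \<Rightarrow> 'v \<Rightarrow> 'v \<Rightarrow> 'v) \<Rightarrow> 'b tree \<Rightarrow> (nat \<Rightarrow> 'v) \<Rightarrow> 'v" where
  "evaluate m \<langle>\<rangle> f = f 0"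
| "evaluate m \<langle>l, a, r\<rangle> f = m a (evaluate m l f) (evaluate m r (\<lambda>i. f (i + size1 l)))"

lemma evaluate_cong: "(\<And>j. j < size1 t \<Longrightarrow> f j = g j) \<Longrightarrow> evaluate m t f = evaluate m t g"
proof (induction t arbitrary: f g)
  case (Node l a r)
  have "evaluate m l f = evaluate m l g" by (rule Node.IH(1)) (simp add: Node.prems)
  moreover have "evaluate m r (\<lambda>i. f (i + size1 l)) = evaluate m r (\<lambda>i. g (i + size1 l))"
    by (rule Node.IH(2)) (simp add: Node.prems)
  ultimately show ?case by simp
qed simp

text \<open>If a tree with \<open>n\<close> leaves is grafted at the \<open>i\<close>-th input, then the inputs after the \<open>i\<close>-th one
  move by \<open>n - 1\<close> places. Since positions in \<open>f\<close> start at 0, the \<open>i\<close>-th input itself has position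
  \<open>i - 1\<close>; its value is overwritten where this function is used.\<close>

definition shift_inputs :: "nat \<Rightarrow> nat \<Rightarrow> (nat \<Rightarrow> 'v) \<Rightarrow> nat \<Rightarrow> 'v" where
  "shift_inputs i n f = (\<lambda>j. if j + 1 < i then f j else f (j + n - 1))"

lemma evaluate_graft:
  assumes "1 \<le> i" "i \<le> size1 t"
  shows "evaluate m (graft t i s) f =
    evaluate m t ((shift_inputs i (size1 s) f)(i - 1 := evaluate m s (\<lambda>k. f (k + i - 1))))"
  using assms
proof (induction t arbitrary: i f)
  case (Node l a r)
  have s: "size1 s > 0" by simp
  show ?case
  proof (cases "i \<le> size1 l")
    case True
    have "(\<lambda>j. f (j + (size1 l + size1 s - 1))) = (\<lambda>j. ((shift_inputs i (size1 s) f)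
        (i - 1 := evaluate m s (\<lambda>k. f (k + i - 1)))) (j + size1 l))"
      using True Node.prems s by (auto simp: shift_inputs_def fun_eq_iff algebra_simps)
    then show ?thesis
      using True Node by (simp add: size1_graft del: size1_size)
  next
    case False
    have left: "evaluate m l f = evaluate m l ((shift_inputs i (size1 s) f)
        (i - 1 := evaluate m s (\<lambda>k. f (k + i - 1))))"
      by (rule evaluate_cong) (use False in \<open>auto simp: shift_inputs_def\<close>)
    have right: "(shift_inputs (i - size1 l) (size1 s) (\<lambda>i. f (i + size1 l)))
        (i - size1 l - 1 := evaluate m s (\<lambda>k. f (k + (i - size1 l) - 1 + size1 l))) =
        (\<lambda>j. ((shift_inputs i (size1 s) f)(i - 1 := evaluate m s (\<lambda>k. f (k + i - 1)))) (j + size1 l))"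
    proof
      fix j
      have "evaluate m s (\<lambda>k. f (k + (i - size1 l) - 1 + size1 l)) = evaluate m s (\<lambda>k. f (k + i - 1))"
        using False by (intro evaluate_cong arg_cong[where f = f]) simp
      then show "((shift_inputs (i - size1 l) (size1 s) (\<lambda>i. f (i + size1 l)))
        (i - size1 l - 1 := evaluate m s (\<lambda>k. f (k + (i - size1 l) - 1 + size1 l)))) j =
        ((shift_inputs i (size1 s) f)(i - 1 := evaluate m s (\<lambda>k. f (k + i - 1)))) (j + size1 l)"
        using False s
        by (auto simp: shift_inputs_def simp del: size1_size intro!: arg_cong[where f = f])
    qed
    have "evaluate m (graft \<langle>l, a, r\<rangle> i s) f =
        m a (evaluate m l f) (evaluate m (graft r (i - size1 l) s) (\<lambda>i. f (i + size1 l)))"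
      using False by simp
    also have "evaluate m (graft r (i - size1 l) s) (\<lambda>i. f (i + size1 l)) =
        evaluate m r (\<lambda>j. ((shift_inputs i (size1 s) f)(i - 1 := evaluate m s (\<lambda>k. f (k + i - 1)))) (j + size1 l))"
      unfolding right[symmetric] by (rule Node.IH(2)) (use False Node.prems in auto)
    finally show ?thesis unfolding evaluate.simps left .
  qed
qed (simp add: fun_upd_def)

locale bilinear_operations =
  fixes m :: "'b \<Rightarrow> ('x \<Rightarrow>\<^sub>0 'k::field) \<Rightarrow> ('x \<Rightarrow>\<^sub>0 'k) \<Rightarrow> ('x \<Rightarrow>\<^sub>0 'k)"
  assumes linear_left: "linear_pm (\<lambda>x. m a x y)" and linear_right: "linear_pm (m a x)"
begin

lemma linear_evaluate:
  "j < size1 t \<Longrightarrow> linear_pm (\<lambda>v. evaluate m t (f(j := v)))"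
proof (induction t arbitrary: j f)
  case (Node l a r)
  show ?case
  proof (cases "j < size1 l")
    case True
    have "(\<lambda>i. (f(j := v)) (i + size1 l)) = (\<lambda>i. f (i + size1 l))" for v
      using True by (auto simp: fun_eq_iff)
    then show ?thesis
      using linear_pm_comp[OF linear_left Node.IH(1)[OF True]] by simp
  next
    case False
    have left: "evaluate m l (f(j := v)) = evaluate m l f" for v
      using False by (intro evaluate_cong) auto
    have right: "(\<lambda>i. (f(j := v)) (i + size1 l)) = (\<lambda>i. f (i + size1 l))(j - size1 l := v)" for v
      using False by (auto simp: fun_eq_iff)
    have "j - size1 l < size1 r" using False Node.prems by simp
    then show ?thesis
      unfolding evaluate.simps left right by (rule linear_pm_comp[OF linear_right Node.IH(2)])
  qed
qed (simp add: linear_pm_ident)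

text \<open>A partial composition is evaluated by feeding the value of the grafted tree into an input
  (\<open>evaluate_graft\<close>), and the value is linear in each input; so the elements that vanish under
  evaluation are closed under everything that generates the ideal. For this the inputs \<open>f\<close> must be
  arbitrary, since grafting onto an element of the ideal replaces its inputs by values of other trees.\<close>

theorem evaluate_ideal_eq_zero:
  assumes rel: "\<And>u v x y z. (u, v) \<in> \<Lambda> \<Longrightarrow>
      lin_map (\<lambda>(a, b). m b (m a x y) z) u = lin_map (\<lambda>(a, b). m a x (m b y z)) v"
    and p: "p \<in> ideal \<Lambda> n"
  shows "lin_map (\<lambda>t. evaluate m t f) p = 0"
proof -
  have "in_generated_ideal free_operad (relators \<Lambda>) n p"
    using p by (simp add: generated_ideal_def)
  then show ?thesis
  proof (induction arbitrary: f)
    case (gen r n)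
    then obtain u v where uv: "(u, v) \<in> \<Lambda>"
      "r = lin_ext (\<lambda>(a, b). \<langle>\<langle>\<langle>\<rangle>, a, \<langle>\<rangle>\<rangle>, b, \<langle>\<rangle>\<rangle>) u - lin_ext (\<lambda>(a, b). \<langle>\<langle>\<rangle>, a, \<langle>\<langle>\<rangle>, b, \<langle>\<rangle>\<rangle>\<rangle>) v"
      by (auto simp: relators_def split: if_splits)
    show ?case
      using rel[OF uv(1), of "f 0" "f 1" "f 2"]
      by (simp add: uv(2) lin_ext_eq_lin_map lin_map_lin_map split_def numeral_2_eq_2)
  next
    case (zero n)
    then show ?case by (simp add: free_operad_def free_vs_def)
  next
    case (add n x y)
    then show ?case by (simp add: free_operad_def free_vs_def)
  next
    case (smult n x c)
    then show ?case by (simp add: free_operad_def free_vs_def)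
  next
    case (compose_left k x y n i)
    have "homogeneous k x"
      using compose_left.hyps(1) ideal_homogeneous by (simp add: generated_ideal_def)
    then have "lin_map (\<lambda>t. evaluate m (graft t i s) f) x =
        lin_map (\<lambda>t. evaluate m t ((shift_inputs i (size1 s) f)
          (i - 1 := evaluate m s (\<lambda>k. f (k + i - 1))))) x" for s
      using compose_left.hyps
      by (intro lin_map_cong evaluate_graft) (auto simp: homogeneous_def)
    then have "lin_map (\<lambda>s. lin_map (\<lambda>t. evaluate m (graft t i s) f) x) y = lin_map (\<lambda>_. 0) y"
      by (simp only: compose_left.IH)
    then show ?case
      by (simp add: partial_comp_free_operad_eq lin_map_lin_map lin_map_swap[of _ y x] lin_map_const_zero)
  next
    case (compose_right x k n y i)
    have "homogeneous k x" "homogeneous n y"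
      using compose_right.hyps ideal_homogeneous
      by (auto simp: generated_ideal_def carrier_free_operad)
    have "lin_map (\<lambda>s. evaluate m (graft t i s) f) y = 0" if t: "t \<in> Poly_Mapping.keys x" for t
    proof -
      have i: "1 \<le> i" "i \<le> size1 t"
        using compose_right.hyps t \<open>homogeneous k x\<close> by (auto simp: homogeneous_def)
      have lin: "linear_pm (\<lambda>v. evaluate m t ((shift_inputs i n f)(i - 1 := v)))"
        using i by (intro linear_evaluate) simp
      have "lin_map (\<lambda>s. evaluate m (graft t i s) f) y = lin_map (\<lambda>s. evaluate m t
          ((shift_inputs i n f)(i - 1 := evaluate m s (\<lambda>k. f (k + i - 1))))) y"
        using i \<open>homogeneous n y\<close>
        by (intro lin_map_cong) (auto simp: homogeneous_def evaluate_graft)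
      also have "\<dots> = evaluate m t ((shift_inputs i n f)
          (i - 1 := lin_map (\<lambda>s. evaluate m s (\<lambda>k. f (k + i - 1))) y))"
        by (rule linear_pm_lin_map[OF lin, symmetric])
      also have "\<dots> = 0" unfolding compose_right.IH by (rule linear_pm_zero[OF lin])
      finally show ?thesis .
    qed
    then have "lin_map (\<lambda>t. lin_map (\<lambda>s. evaluate m (graft t i s) f) y) x = lin_map (\<lambda>_. 0) x"
      by (rule lin_map_cong)
    then show ?case
      by (simp add: partial_comp_free_operad_eq lin_map_lin_map lin_map_const_zero)
  qed
qed

end

section \<open>The relations of Quad as rewriting rules\<close>

lemma relation_vectorspace:
  "vectorspace class_ring (direct_sum (free_vs UNIV) (free_vs UNIV) :: ('k::field, ('b, 'k) relation) module)"
  by (intro direct_sum_is_vs vectorspace_free_vs)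

lemma relation_module:
  "Module.module class_ring (direct_sum (free_vs UNIV) (free_vs UNIV) :: ('k::field, ('b, 'k) relation) module)"
  using relation_vectorspace by (rule vectorspace.axioms)

lemma carrier_relations: "carrier (direct_sum (free_vs UNIV) (free_vs UNIV)) = UNIV"
  by (simp add: direct_sum_def free_vs_def)

lemma relation_span_base: "r \<in> S \<Longrightarrow> r \<in> relation_span S"
  unfolding relation_span_def
  by (rule subsetD[OF LinearCombinations.module.in_own_span[OF relation_module]]) (simp_all add: carrier_relations)

lemma submodule_relation_span:
  "LinearCombinations.submodule class_ring (relation_span S) (direct_sum (free_vs UNIV) (free_vs UNIV))"
  unfolding relation_span_def
  by (rule LinearCombinations.module.span_is_submodule[OF relation_module]) (simp add: carrier_relations)

lemma relation_span_zero: "(0, 0) \<in> relation_span S"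
  using submodule.zero_closed[OF submodule_relation_span, of S]
  by (simp add: direct_sum_def free_vs_def)

lemma relation_span_add:
  "(u, v) \<in> relation_span S \<Longrightarrow> (u', v') \<in> relation_span S \<Longrightarrow> (u + u', v + v') \<in> relation_span S"
  using submodule.m_closed[OF submodule_relation_span, of "(u, v)" S "(u', v')"]
  by (simp add: direct_sum_def free_vs_def)

lemma relation_span_scale:
  "(u, v) \<in> relation_span S \<Longrightarrow> (c \<cdot> u, c \<cdot> v) \<in> relation_span S"
  using submodule.smult_closed[OF submodule_relation_span, of c "(u, v)" S]
  by (simp add: direct_sum_def free_vs_def)

lemma relation_span_diff:
  "(u, v) \<in> relation_span S \<Longrightarrow> (u', v') \<in> relation_span S \<Longrightarrow> (u - u', v - v') \<in> relation_span S"
  using relation_span_add[of u v S "- u'" "- v'"] relation_span_scale[of u' v' S "-1"] by simp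

lemma relation_span_induct [consumes 1, case_names base zero add scale]:
  assumes "(u, v) \<in> relation_span S"
    and base: "\<And>u v. (u, v) \<in> S \<Longrightarrow> P u v" and zero: "P 0 0"
    and add: "\<And>u v u' v'. P u v \<Longrightarrow> P u' v' \<Longrightarrow> P (u + u') (v + v')"
    and scale: "\<And>c u v. P u v \<Longrightarrow> P (c \<cdot> u) (c \<cdot> v)"
  shows "P u v"
proof -
  have "relation_span S \<subseteq> {(u, v). P u v}"
    unfolding relation_span_def
  proof (rule LinearCombinations.module.span_is_subset[OF relation_module])
    show "S \<subseteq> {(u, v). P u v}" using base by auto
    show "submodule class_ring {(u, v). P u v} (direct_sum (free_vs UNIV) (free_vs UNIV))"
      by (intro submodule.intro relation_module)
        (auto simp: direct_sum_def free_vs_def intro: zero add scale)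
  qed
  then show ?thesis using assms(1) by auto
qed

lemma linear_S23: "linear_pm S23"
  unfolding S23_def lin_ext_eq_lin_map by (rule linear_lin_map)

fun op_vec :: "half_op \<Rightarrow> (dend_op \<Rightarrow>\<^sub>0 'k::field)" where
  "op_vec Half = basis_vec Prec"
| "op_vec Full = basis_vec Prec + basis_vec Succ"

definition dend_rule :: "half_op \<Rightarrow> half_op \<Rightarrow> (dend_op, 'k::field) relation" where
  "dend_rule a p = (tensor (op_vec a) (op_vec p),
    \<Sum>b\<in>UNIV. \<Sum>c\<in>UNIV. dend_coeff a p b c \<cdot> tensor (op_vec b) (op_vec c))"

lemmas tensor_linear_simps =
  linear_pm_add[OF linear_tensor(1)] linear_pm_add[OF linear_tensor(2)]
  linear_pm_diff[OF linear_tensor(1)] linear_pm_diff[OF linear_tensor(2)]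
  linear_pm_zero[OF linear_tensor(1)] linear_pm_zero[OF linear_tensor(2)]
  linear_pm_scale[OF linear_tensor(1)] linear_pm_scale[OF linear_tensor(2)]

lemma dend_rule_simps:
  "dend_rule Half Half = (tensor (op_vec Half) (op_vec Half), tensor (op_vec Half) (op_vec Full))"
  "dend_rule Full Half = (tensor (op_vec Full) (op_vec Half),
    tensor (op_vec Half) (op_vec Full) + tensor (op_vec Full) (op_vec Half) - tensor (op_vec Half) (op_vec Half))"
  "dend_rule Full Full = (tensor (op_vec Full) (op_vec Full), tensor (op_vec Full) (op_vec Full))"
  by (simp_all add: dend_rule_def UNIV_half_op pm.scale_minus_left del: op_vec.simps)

text \<open>The rules for \<open>\<prec>\<prec>\<close>, \<open>*\<prec>\<close>, \<open>**\<close> are the first, the sum of the first two, and the sum of all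
  three of the defining relations.\<close>

lemma dend_relations_eq_span_rules:
  "dend_relations = relation_span {dend_rule a p | a p. dend_lead a p}"
proof -
  define G :: "(dend_op, 'a) relation set" where
    "G = {(tensor (op_vec Half) (op_vec Half), tensor (op_vec Half) (op_vec Full)),
      (tensor (basis_vec Succ) (op_vec Half), tensor (basis_vec Succ) (op_vec Half)),
      (tensor (op_vec Full) (basis_vec Succ), tensor (basis_vec Succ) (basis_vec Succ))}"
  define R :: "(dend_op, 'a) relation set" where "R = {dend_rule a p | a p. dend_lead a p}"
  have rules: "dend_rule Half Half \<in> R" "dend_rule Full Half \<in> R" "dend_rule Full Full \<in> R"
    by (auto simp: R_def dend_lead_def)
  have 1: "(u, v) \<in> relation_span R" if "(u, v) \<in> G" for u v
  proof -
    have "(tensor (op_vec Half) (op_vec Half), tensor (op_vec Half) (op_vec Full)) \<in> relation_span R"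
      using relation_span_base[OF rules(1)] by (simp only: dend_rule_simps)
    moreover have "(tensor (basis_vec Succ) (op_vec Half), tensor (basis_vec Succ) (op_vec Half)) \<in> relation_span R"
      using relation_span_diff[OF relation_span_base[OF rules(2)[unfolded dend_rule_simps]]
          relation_span_base[OF rules(1)[unfolded dend_rule_simps]]]
      by (simp add: tensor_linear_simps)
    moreover have "(tensor (op_vec Full) (basis_vec Succ), tensor (basis_vec Succ) (basis_vec Succ)) \<in> relation_span R"
      using relation_span_diff[OF relation_span_base[OF rules(3)[unfolded dend_rule_simps]]
          relation_span_base[OF rules(2)[unfolded dend_rule_simps]]]
      by (simp add: tensor_linear_simps)
    ultimately show ?thesis using that by (auto simp: G_def simp del: op_vec.simps)
  qed
  have gens: "(tensor (op_vec Half) (op_vec Half), tensor (op_vec Half) (op_vec Full)) \<in> relation_span G"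
      "(tensor (basis_vec Succ) (op_vec Half), tensor (basis_vec Succ) (op_vec Half)) \<in> relation_span G"
      "(tensor (op_vec Full) (basis_vec Succ), tensor (basis_vec Succ) (basis_vec Succ)) \<in> relation_span G"
    by (rule relation_span_base, simp add: G_def)+
  have 2: "(u, v) \<in> relation_span G" if uv: "(u, v) \<in> R" for u v
  proof -
    note FH = relation_span_add[OF gens(1,2)]
    have "dend_rule Half Half \<in> relation_span G"
      using gens(1) by (simp only: dend_rule_simps)
    moreover have "dend_rule Full Half \<in> relation_span G"
      using FH by (simp add: dend_rule_simps tensor_linear_simps algebra_simps)
    moreover have "dend_rule Full Full \<in> relation_span G"
      using relation_span_add[OF FH gens(3)] by (simp add: dend_rule_simps tensor_linear_simps algebra_simps)
    moreover obtain a p where "dend_lead a p" "(u, v) = dend_rule a p"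
      using uv unfolding R_def by blast
    ultimately show ?thesis by (cases a; cases p) (simp_all add: dend_lead_def)
  qed
  have "relation_span G = relation_span R"
  proof (intro equalityI subrelI)
    show "(u, v) \<in> relation_span R" if "(u, v) \<in> relation_span G" for u v
      using that
      by (induction rule: relation_span_induct)
        (auto intro: 1 relation_span_add relation_span_scale relation_span_zero)
    show "(u, v) \<in> relation_span G" if "(u, v) \<in> relation_span R" for u v
      using that
      by (induction rule: relation_span_induct)
        (auto intro: 2 relation_span_add relation_span_scale relation_span_zero)
  qed
  then show ?thesis
    by (simp add: dend_relations_def Let_def G_def R_def)
qed

lemma sum_UNIV_pair: "(\<Sum>p\<in>UNIV. f p) = (\<Sum>a\<in>UNIV. \<Sum>b\<in>UNIV. f (a, b))"
  for f :: "'a::finite \<times> 'b::finite \<Rightarrow> 'c::comm_monoid_add"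
  by (simp add: sum.cartesian_product split_def flip: UNIV_Times_UNIV)

context bilinear_operations
begin

definition op_of :: "('b \<Rightarrow>\<^sub>0 'k) \<Rightarrow> ('x \<Rightarrow>\<^sub>0 'k) \<Rightarrow> ('x \<Rightarrow>\<^sub>0 'k) \<Rightarrow> ('x \<Rightarrow>\<^sub>0 'k)" where
  "op_of w x y = lin_map (\<lambda>s. m s x y) w"

lemma linear_op_of: "linear_pm (\<lambda>x. op_of w x y)" "linear_pm (op_of w x)"
  unfolding op_of_def by (intro linear_lin_map_family linear_left linear_right)+

definition left_value :: "('x \<Rightarrow>\<^sub>0 'k) \<Rightarrow> ('x \<Rightarrow>\<^sub>0 'k) \<Rightarrow> ('x \<Rightarrow>\<^sub>0 'k) \<Rightarrow> ('b \<times> 'b \<Rightarrow>\<^sub>0 'k) \<Rightarrow> ('x \<Rightarrow>\<^sub>0 'k)" where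
  "left_value x y z = lin_map (\<lambda>(a, b). m b (m a x y) z)"

definition right_value :: "('x \<Rightarrow>\<^sub>0 'k) \<Rightarrow> ('x \<Rightarrow>\<^sub>0 'k) \<Rightarrow> ('x \<Rightarrow>\<^sub>0 'k) \<Rightarrow> ('b \<times> 'b \<Rightarrow>\<^sub>0 'k) \<Rightarrow> ('x \<Rightarrow>\<^sub>0 'k)" where
  "right_value x y z = lin_map (\<lambda>(a, b). m a x (m b y z))"

lemma linear_values: "linear_pm (left_value x y z)" "linear_pm (right_value x y z)"
  unfolding left_value_def right_value_def by (rule linear_lin_map)+

end

text \<open>\<open>S23\<close> brings the two inner operations together and the two outer ones, so that a product of left
  combs is a left comb of products; \<open>right_value_S23\<close> is the analogue for right combs.\<close>

lemma left_value_S23: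
  fixes m :: "'a \<times> 'b \<Rightarrow> ('x \<Rightarrow>\<^sub>0 'k::field) \<Rightarrow> ('x \<Rightarrow>\<^sub>0 'k) \<Rightarrow> ('x \<Rightarrow>\<^sub>0 'k)"
  assumes "bilinear_operations m"
  shows "bilinear_operations.left_value m x y z (S23 (tensor (tensor A P) (tensor A' P'))) =
    bilinear_operations.op_of m (tensor P P') (bilinear_operations.op_of m (tensor A A') x y) z"
proof -
  interpret bilinear_operations m by (rule assms)
  have op_of_tensor: "op_of (tensor v w) x y = lin_map (\<lambda>a. lin_map (\<lambda>b. m (a, b) x y) w) v" for v w x y
    by (simp add: op_of_def tensor_eq_lin_map lin_map_lin_map)
  have "left_value x y z (S23 (tensor (tensor A P) (tensor A' P'))) =
      lin_map (\<lambda>a. lin_map (\<lambda>p. lin_map (\<lambda>a'. lin_map (\<lambda>p'. m (p, p') (m (a, a') x y) z) P') A') P) A"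
    by (simp add: left_value_def S23_def lin_ext_eq_lin_map tensor_eq_lin_map lin_map_lin_map)
  also have "\<dots> = lin_map (\<lambda>a. lin_map (\<lambda>a'. lin_map (\<lambda>p. lin_map (\<lambda>p'. m (p, p') (m (a, a') x y) z) P') P) A') A"
    by (subst lin_map_swap[of _ A' P]) (rule refl)
  also have "\<dots> = op_of (tensor P P') (op_of (tensor A A') x y) z"
    unfolding op_of_tensor[of A A'] linear_pm_lin_map[OF linear_op_of(1)] unfolding op_of_tensor ..
  finally show ?thesis .
qed

lemma right_value_S23:
  fixes m :: "'a \<times> 'b \<Rightarrow> ('x \<Rightarrow>\<^sub>0 'k::field) \<Rightarrow> ('x \<Rightarrow>\<^sub>0 'k) \<Rightarrow> ('x \<Rightarrow>\<^sub>0 'k)"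
  assumes "bilinear_operations m"
  shows "bilinear_operations.right_value m x y z (S23 (tensor (tensor B C) (tensor B' C'))) =
    bilinear_operations.op_of m (tensor B B') x (bilinear_operations.op_of m (tensor C C') y z)"
proof -
  interpret bilinear_operations m by (rule assms)
  have op_of_tensor: "op_of (tensor v w) x y = lin_map (\<lambda>a. lin_map (\<lambda>b. m (a, b) x y) w) v" for v w x y
    by (simp add: op_of_def tensor_eq_lin_map lin_map_lin_map)
  have "right_value x y z (S23 (tensor (tensor B C) (tensor B' C'))) =
      lin_map (\<lambda>b. lin_map (\<lambda>c. lin_map (\<lambda>b'. lin_map (\<lambda>c'. m (b, b') x (m (c, c') y z)) C') B') C) B"
    by (simp add: right_value_def S23_def lin_ext_eq_lin_map tensor_eq_lin_map lin_map_lin_map)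
  also have "\<dots> = lin_map (\<lambda>c. lin_map (\<lambda>c'. lin_map (\<lambda>b. lin_map (\<lambda>b'. m (b, b') x (m (c, c') y z)) B') B) C') C"
    by (subst lin_map_swap[of _ C B], subst lin_map_swap[of _ C' B'], subst lin_map_swap[of _ C' B]) (rule refl)
  also have "\<dots> = op_of (tensor B B') x (op_of (tensor C C') y z)"
    unfolding op_of_tensor[of C C'] linear_pm_lin_map[OF linear_op_of(2)] unfolding op_of_tensor ..
  finally show ?thesis .
qed

abbreviation quad_relations :: "(dend_op \<times> dend_op, 'k::field) relation set" where
  "quad_relations \<equiv> dend_relations \<box> dend_relations"

abbreviation quad_coeff :: "half_op \<times> half_op \<Rightarrow> half_op \<times> half_op \<Rightarrow> half_op \<times> half_op \<Rightarrow>
    half_op \<times> half_op \<Rightarrow> 'k::field" where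
  "quad_coeff \<equiv> pair_coeff dend_coeff dend_coeff"

locale quad_operations = bilinear_operations m
  for m :: "dend_op \<times> dend_op \<Rightarrow> ('x \<Rightarrow>\<^sub>0 'k::field) \<Rightarrow> ('x \<Rightarrow>\<^sub>0 'k) \<Rightarrow> ('x \<Rightarrow>\<^sub>0 'k)"
begin

text \<open>The pairs of operations \<open>\<prec>\<close> and \<open>*\<close>, expressed by the given operations \<open>m\<close>.\<close>

definition hat :: "half_op \<times> half_op \<Rightarrow> ('x \<Rightarrow>\<^sub>0 'k) \<Rightarrow> ('x \<Rightarrow>\<^sub>0 'k) \<Rightarrow> ('x \<Rightarrow>\<^sub>0 'k)" where
  "hat p = op_of (tensor (op_vec (fst p)) (op_vec (snd p)))"

lemma linear_hat: "linear_pm (\<lambda>x. hat p x y)" "linear_pm (hat p x)"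
  unfolding hat_def by (rule linear_op_of)+

text \<open>The inverse change of generators, from \<open>\<succ> = * - \<prec>\<close> in each factor.\<close>

lemma op_eq_hat:
  "m (Prec, Prec) x y = hat (Half, Half) x y"
  "m (Prec, Succ) x y = hat (Half, Full) x y - hat (Half, Half) x y"
  "m (Succ, Prec) x y = hat (Full, Half) x y - hat (Half, Half) x y"
  "m (Succ, Succ) x y = hat (Full, Full) x y - hat (Full, Half) x y - hat (Half, Full) x y + hat (Half, Half) x y"
  by (simp_all add: hat_def op_of_def tensor_linear_simps)

lemma left_value_rules:
  "left_value x y z (S23 (tensor (fst (dend_rule a p)) (fst (dend_rule a' p')))) =
    hat (p, p') (hat (a, a') x y) z"
  by (simp add: dend_rule_def left_value_S23[OF bilinear_operations_axioms] hat_def)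

lemma right_value_rules:
  "right_value x y z (S23 (tensor (snd (dend_rule a p)) (snd (dend_rule a' p')))) =
    (\<Sum>b\<in>UNIV. \<Sum>c\<in>UNIV. quad_coeff (a, a') (p, p') b c \<cdot> hat b x (hat c y z))"
proof -
  have lin: "linear_pm (\<lambda>v. right_value x y z (S23 (tensor v w)))"
    "linear_pm (\<lambda>w. right_value x y z (S23 (tensor v w)))" for v w
    by (intro linear_pm_comp[OF linear_values(2)] linear_pm_comp[OF linear_S23] linear_tensor)+
  have "right_value x y z (S23 (tensor (snd (dend_rule a p)) (snd (dend_rule a' p')))) =
      (\<Sum>b'\<in>UNIV. \<Sum>c'\<in>UNIV. \<Sum>b\<in>UNIV. \<Sum>c\<in>UNIV. (dend_coeff a' p' b' c' * dend_coeff a p b c) \<cdot>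
        hat (b, b') x (hat (c, c') y z))"
    by (simp add: dend_rule_def linear_pm_sum[OF lin(1)] linear_pm_scale[OF lin(1)]
        linear_pm_sum[OF lin(2)] linear_pm_scale[OF lin(2)] pm.scale_sum_right
        right_value_S23[OF bilinear_operations_axioms] hat_def del: op_vec.simps)
  also have "\<dots> = (\<Sum>b\<in>UNIV. \<Sum>c\<in>UNIV. \<Sum>b'\<in>UNIV. \<Sum>c'\<in>UNIV. (dend_coeff a' p' b' c' * dend_coeff a p b c) \<cdot>
        hat (b, b') x (hat (c, c') y z))"
    by (rule sum_swap_pairs)
  also have "\<dots> = (\<Sum>b\<in>UNIV. \<Sum>b'\<in>UNIV. \<Sum>c\<in>UNIV. \<Sum>c'\<in>UNIV. (dend_coeff a' p' b' c' * dend_coeff a p b c) \<cdot>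
        hat (b, b') x (hat (c, c') y z))"
    by (rule sum.cong[OF refl], rule sum.swap)
  also have "\<dots> = (\<Sum>b\<in>UNIV. \<Sum>c\<in>UNIV. quad_coeff (a, a') (p, p') b c \<cdot> hat b x (hat c y z))"
    by (simp add: sum_UNIV_pair pair_coeff_def mult.commute)
  finally show ?thesis .
qed

text \<open>Both sides of a relation of the black square product are bilinear in the two relations of Dend that it
  comes from, so it suffices to consider products of rules.\<close>

lemma quad_relations_hold:
  assumes rules: "\<And>a p x y z. quad_lead a p \<Longrightarrow>
      hat p (hat a x y) z = (\<Sum>b\<in>UNIV. \<Sum>c\<in>UNIV. quad_coeff a p b c \<cdot> hat b x (hat c y z))"
    and rel: "(u, v) \<in> quad_relations"
  shows "left_value x y z u = right_value x y z v"
proof -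
  have lin: "linear_pm (\<lambda>v. left_value x y z (S23 (tensor v w)))"
    "linear_pm (\<lambda>w. left_value x y z (S23 (tensor v w)))"
    "linear_pm (\<lambda>v. right_value x y z (S23 (tensor v w)))"
    "linear_pm (\<lambda>w. right_value x y z (S23 (tensor v w)))" for v w
    by (intro linear_pm_comp[OF linear_values(1)] linear_pm_comp[OF linear_values(2)]
        linear_pm_comp[OF linear_S23] linear_tensor)+
  have gen: "left_value x y z (S23 (tensor (fst (dend_rule a p)) (fst (dend_rule a' p')))) =
      right_value x y z (S23 (tensor (snd (dend_rule a p)) (snd (dend_rule a' p'))))"
    if "dend_lead a p" "dend_lead a' p'" for a p a' p'
    unfolding left_value_rules right_value_rules by (rule rules) (use that in \<open>simp add: pair_lead_def\<close>)
  have 1: "left_value x y z (S23 (tensor u (fst (dend_rule a' p')))) =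
      right_value x y z (S23 (tensor v (snd (dend_rule a' p'))))"
    if "(u, v) \<in> dend_relations" "dend_lead a' p'" for u v a' p'
    using that(1) unfolding dend_relations_eq_span_rules
  proof (induction rule: relation_span_induct)
    case (base u v)
    then obtain a p where "dend_lead a p" "(u, v) = dend_rule a p" by blast
    then show ?case using gen[of a p a' p'] that(2) by (metis fst_conv snd_conv)
  qed (simp_all add: linear_pm_zero[OF lin(1)] linear_pm_zero[OF lin(3)] linear_pm_add[OF lin(1)]
      linear_pm_add[OF lin(3)] linear_pm_scale[OF lin(1)] linear_pm_scale[OF lin(3)])
  have 2: "left_value x y z (S23 (tensor u u')) = right_value x y z (S23 (tensor v v'))"
    if "(u, v) \<in> dend_relations" "(u', v') \<in> dend_relations" for u v u' v'
    using that(2) unfolding dend_relations_eq_span_rules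
  proof (induction rule: relation_span_induct)
    case (base u' v')
    then obtain a' p' where "dend_lead a' p'" "(u', v') = dend_rule a' p'" by blast
    then show ?case using 1[OF that(1), of a' p'] by (metis fst_conv snd_conv)
  qed (simp_all add: linear_pm_zero[OF lin(2)] linear_pm_zero[OF lin(4)] linear_pm_add[OF lin(2)]
      linear_pm_add[OF lin(4)] linear_pm_scale[OF lin(2)] linear_pm_scale[OF lin(4)])
  show ?thesis
    using rel unfolding black_square_def
  proof (induction rule: relation_span_induct)
    case (base u v)
    then show ?case using 2 by blast
  qed (simp_all add: linear_pm_zero[OF linear_values(1)] linear_pm_zero[OF linear_values(2)]
      linear_pm_add[OF linear_values(1)] linear_pm_add[OF linear_values(2)]
      linear_pm_scale[OF linear_values(1)] linear_pm_scale[OF linear_values(2)])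
qed

end

interpretation tree_ops: quad_operations
  "node :: dend_op \<times> dend_op \<Rightarrow> ((dend_op \<times> dend_op) tree \<Rightarrow>\<^sub>0 'k::field) \<Rightarrow> _"
  by standard (rule linear_node)+

lemma ideal_lin_map: "(\<And>x. x \<in> Poly_Mapping.keys p \<Longrightarrow> f x \<in> ideal \<Lambda> n) \<Longrightarrow> lin_map f p \<in> ideal \<Lambda> n"
  unfolding lin_map_def by (intro ideal_sum ideal_scale)

lemma homogeneous_hat:
  "homogeneous k x \<Longrightarrow> homogeneous l y \<Longrightarrow> homogeneous (k + l) (tree_ops.hat p x y)"
  unfolding tree_ops.hat_def tree_ops.op_of_def by (intro homogeneous_lin_map homogeneous_node)

lemma ideal_hat_cong:
  assumes "x - x' \<in> ideal \<Lambda> k" "y - y' \<in> ideal \<Lambda> l" "homogeneous k x'" "homogeneous l y"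
  shows "tree_ops.hat p x y - tree_ops.hat p x' y' \<in> ideal \<Lambda> (k + l)"
proof -
  have "tree_ops.hat p x y - tree_ops.hat p x' y' =
      lin_map (\<lambda>s. node s x y - node s x' y') (tensor (op_vec (fst p)) (op_vec (snd p)))"
    unfolding tree_ops.hat_def tree_ops.op_of_def lin_map_def
    by (simp add: pm.scale_right_diff_distrib sum_subtractf)
  also have "\<dots> \<in> ideal \<Lambda> (k + l)" by (intro ideal_lin_map ideal_node_cong assms)
  finally show ?thesis .
qed

lemma ideal_quad_rule:
  assumes "quad_lead a p" and hom: "homogeneous k x" "homogeneous l y" "homogeneous m z"
  shows "tree_ops.hat p (tree_ops.hat a x y) z -
    (\<Sum>b\<in>UNIV. \<Sum>c\<in>UNIV. quad_coeff a p b c \<cdot> tree_ops.hat b x (tree_ops.hat c y z))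
    \<in> ideal quad_relations (k + l + m)"
proof -
  obtain a1 a2 p1 p2 where ap: "a = (a1, a2)" "p = (p1, p2)" by fastforce
  have rules: "dend_rule a1 p1 \<in> dend_relations" "dend_rule a2 p2 \<in> dend_relations"
    using assms(1) unfolding dend_relations_eq_span_rules ap pair_lead_def
    by (auto intro: relation_span_base)
  have "(S23 (tensor (fst (dend_rule a1 p1)) (fst (dend_rule a2 p2))),
      S23 (tensor (snd (dend_rule a1 p1)) (snd (dend_rule a2 p2)))) \<in> quad_relations"
    unfolding black_square_def 
    by (intro relation_span_base CollectI exI conjI, rule refl) (simp_all add: rules)
  from ideal_relation[OF this hom] show ?thesis
    unfolding tree_ops.left_value_def[symmetric] tree_ops.right_value_def[symmetric]
      tree_ops.left_value_rules tree_ops.right_value_rules ap .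
qed

section \<open>An algebra over Quad on the space of trees\<close>

interpretation quad: left_comb_rewriting quad_lead
  "quad_coeff :: half_op \<times> half_op \<Rightarrow> half_op \<times> half_op \<Rightarrow> _ \<Rightarrow> _ \<Rightarrow> 'k::field"
  by (intro left_comb_rewriting_pair left_comb_rewriting_dend)

abbreviation quad_act :: "(half_op \<times> half_op) tree \<Rightarrow> half_op \<times> half_op \<Rightarrow>
    ((half_op \<times> half_op) tree \<Rightarrow>\<^sub>0 'k::field) \<Rightarrow> _" where
  "quad_act \<equiv> left_comb_rewriting.act quad_lead quad_coeff"

text \<open>The operations of Quad on the space of trees. Since \<open>quad.mul\<close> interprets the generators in terms of
  \<open>\<prec>\<close> and \<open>*\<close>, they are given by the formulas of \<open>op_eq_hat\<close>.\<close>

fun model_op :: "dend_op \<times> dend_op \<Rightarrow> ((half_op \<times> half_op) tree \<Rightarrow>\<^sub>0 'k::field) \<Rightarrow>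
    ((half_op \<times> half_op) tree \<Rightarrow>\<^sub>0 'k) \<Rightarrow> ((half_op \<times> half_op) tree \<Rightarrow>\<^sub>0 'k)" where
  "model_op (Prec, Prec) x y = quad.mul (Half, Half) x y"
| "model_op (Prec, Succ) x y = quad.mul (Half, Full) x y - quad.mul (Half, Half) x y"
| "model_op (Succ, Prec) x y = quad.mul (Full, Half) x y - quad.mul (Half, Half) x y"
| "model_op (Succ, Succ) x y =
    quad.mul (Full, Full) x y - quad.mul (Full, Half) x y - quad.mul (Half, Full) x y + quad.mul (Half, Half) x y"

lemma dend_op_pair_cases:
  obtains "a = (Prec, Prec)" | "a = (Prec, Succ)" | "a = (Succ, Prec)" | "a = (Succ, Succ)"
  by (metis dend_op.exhaust surj_pair)

interpretation model: quad_operations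
  "model_op :: dend_op \<times> dend_op \<Rightarrow> ((half_op \<times> half_op) tree \<Rightarrow>\<^sub>0 'k::field) \<Rightarrow> _"
proof
  fix a :: "dend_op \<times> dend_op" and x y :: "(half_op \<times> half_op) tree \<Rightarrow>\<^sub>0 'k"
  show "linear_pm (\<lambda>x. model_op a x y)"
    by (cases a rule: dend_op_pair_cases) (auto intro!: linear_pm_plus linear_pm_sub quad.linear_mul)
  show "linear_pm (model_op a x)"
    by (cases a rule: dend_op_pair_cases)
      (simp_all add: linear_pm_def linear_pm_add[OF quad.linear_mul(2)]
        linear_pm_scale[OF quad.linear_mul(2)] pm.scale_right_diff_distrib pm.scale_right_distrib)
qed

lemma model_hat: "model.hat p = quad.mul p"
proof (intro ext)
  fix x y show "model.hat p x y = quad.mul p x y"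
    by (cases p; cases "fst p"; cases "snd p")
      (simp_all add: model.hat_def model.op_of_def tensor_linear_simps)
qed

lemma model_relations:
  "(u, v) \<in> quad_relations \<Longrightarrow> model.left_value x y z u = model.right_value x y z v"
  by (rule model.quad_relations_hold) (simp_all add: model_hat quad.mul_mul)

lemma lin_map_diff_family: "lin_map (\<lambda>x. f x - g x) p = lin_map f p - lin_map g p"
  by (simp add: lin_map_def pm.scale_right_diff_distrib sum_subtractf)

definition to_model :: "((dend_op \<times> dend_op) tree \<Rightarrow>\<^sub>0 'k::field) \<Rightarrow> ((half_op \<times> half_op) tree \<Rightarrow>\<^sub>0 'k)" where
  "to_model = lin_map (\<lambda>t. evaluate model_op t (\<lambda>_. basis_vec \<langle>\<rangle>))"

lemma to_model_ideal: "p \<in> ideal quad_relations n \<Longrightarrow> to_model p = 0"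
  unfolding to_model_def
  by (rule model.evaluate_ideal_eq_zero)
    (use model_relations in \<open>simp_all add: model.left_value_def model.right_value_def\<close>)

lemma linear_to_model: "linear_pm to_model"
  unfolding to_model_def by (rule linear_lin_map)

lemma to_model_node: "to_model (node a x y) = model_op a (to_model x) (to_model y)"
proof -
  have "model_op a (to_model x) (to_model y) = lin_map (\<lambda>l. lin_map (\<lambda>r.
      model_op a (evaluate model_op l (\<lambda>_. basis_vec \<langle>\<rangle>)) (evaluate model_op r (\<lambda>_. basis_vec \<langle>\<rangle>))) y) x"
    unfolding to_model_def
    by (simp add: linear_pm_lin_map[OF model.linear_left] linear_pm_lin_map[OF model.linear_right])
      (rule lin_map_swap)
  then show ?thesis by (simp add: to_model_def node_def lin_map_lin_map)
qed

lemma to_model_hat: "to_model (tree_ops.hat p x y) = quad.mul p (to_model x) (to_model y)"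
proof -
  have "to_model (tree_ops.hat p x y) = model.hat p (to_model x) (to_model y)"
    unfolding tree_ops.hat_def tree_ops.op_of_def model.hat_def model.op_of_def
      linear_pm_lin_map[OF linear_to_model] to_model_node ..
  then show ?thesis by (simp add: model_hat)
qed

text \<open>The element of the free operad obtained from a tree by expanding each \<open>*\<close> at its nodes into
  \<open>\<prec> + \<succ>\<close>.\<close>

primrec from_model_tree :: "(half_op \<times> half_op) tree \<Rightarrow> ((dend_op \<times> dend_op) tree \<Rightarrow>\<^sub>0 'k::field)" where
  "from_model_tree \<langle>\<rangle> = basis_vec \<langle>\<rangle>"
| "from_model_tree \<langle>l, p, r\<rangle> = tree_ops.hat p (from_model_tree l) (from_model_tree r)"

lemma homogeneous_from_model_tree: "homogeneous (size1 t) (from_model_tree t)"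
  by (induction t) (simp_all add: homogeneous_hat)

lemma to_model_from_model_tree:
  "reduced quad_lead t \<Longrightarrow> to_model (from_model_tree t) = (basis_vec t :: _ \<Rightarrow>\<^sub>0 'k::field)"
proof (induction t)
  case Leaf
  show ?case by (simp add: to_model_def)
next
  case (Node l p r)
  then have "to_model (from_model_tree \<langle>l, p, r\<rangle>) = quad_act l p (basis_vec r :: _ \<Rightarrow>\<^sub>0 'k)"
    by (simp add: to_model_hat)
  also have "\<dots> = basis_vec \<langle>l, p, r\<rangle>"
    using Node.prems by (subst quad.act_irreducible) auto
  finally show ?case .
qed

definition from_model :: "((half_op \<times> half_op) tree \<Rightarrow>\<^sub>0 'k::field) \<Rightarrow> ((dend_op \<times> dend_op) tree \<Rightarrow>\<^sub>0 'k)" where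
  "from_model = lin_map from_model_tree"

lemma linear_from_model: "linear_pm from_model"
  unfolding from_model_def by (rule linear_lin_map)

lemma homogeneous_from_model: "homogeneous n z \<Longrightarrow> homogeneous n (from_model z)"
  unfolding from_model_def
  by (intro homogeneous_lin_map) (use homogeneous_from_model_tree in \<open>force simp: homogeneous_def[of n z]\<close>)

lemma homogeneous_quad_act: "homogeneous n z \<Longrightarrow> homogeneous (size1 t + n) (quad_act t p z)"
proof (induction t arbitrary: p z n)
  case Leaf
  then show ?case by (auto simp: homogeneous_def[of n z] intro!: homogeneous_lin_map)
next
  case (Node u q w)
  show ?case
  proof (cases "quad_lead q p")
    case True
    have "homogeneous (size1 u + (size1 w + n)) (quad_act u b (quad_act w c z))" for b c
      by (intro Node)
    then have "homogeneous (size1 \<langle>u, q, w\<rangle> + n) (quad_act u b (quad_act w c z))" for b c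
      by (simp add: add.assoc)
    then show ?thesis using True by (auto intro!: homogeneous_sum homogeneous_scale)
  next
    case False
    then show ?thesis using Node.prems by (auto simp: homogeneous_def[of n z] intro!: homogeneous_lin_map)
  qed
qed

text \<open>The product in the algebra of trees was defined by applying the rules, and these hold in the free
  operad modulo the ideal; so \<open>from_model\<close> is multiplicative modulo the ideal.\<close>

lemma from_model_quad_act:
  fixes z :: "(half_op \<times> half_op) tree \<Rightarrow>\<^sub>0 'k::field"
  assumes "homogeneous n z"
  shows "from_model (quad_act t p z) - tree_ops.hat p (from_model_tree t) (from_model z)
    \<in> ideal quad_relations (size1 t + n)"
  using assms
proof (induction t arbitrary: p z n)
  case Leaf
  have "from_model (quad_act \<langle>\<rangle> p z) = tree_ops.hat p (from_model_tree \<langle>\<rangle>) (from_model z)"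
    by (simp add: from_model_def lin_map_lin_map linear_pm_lin_map[OF tree_ops.linear_hat(2)])
  then show ?case by (simp add: ideal_zero)
next
  case (Node u q w)
  show ?case
  proof (cases "quad_lead q p")
    case False
    then have "from_model (quad_act \<langle>u, q, w\<rangle> p z) = tree_ops.hat p (from_model_tree \<langle>u, q, w\<rangle>) (from_model z)"
      by (simp add: from_model_def lin_map_lin_map linear_pm_lin_map[OF tree_ops.linear_hat(2)])
    then show ?thesis by (simp only: diff_self ideal_zero)
  next
    case True
    let ?N = "size1 u + size1 w + n"
    have step: "from_model (quad_act u b (quad_act w c z)) -
        tree_ops.hat b (from_model_tree u) (tree_ops.hat c (from_model_tree w) (from_model z))
        \<in> ideal quad_relations ?N" for b c
    proof (rule ideal_trans)
      show "from_model (quad_act u b (quad_act w c z)) - tree_ops.hat b (from_model_tree u) (from_model (quad_act w c z))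
          \<in> ideal quad_relations ?N"
        using Node.IH(1)[OF homogeneous_quad_act[OF Node.prems], of b w c] by (simp add: add.assoc)
      have "tree_ops.hat b (from_model_tree u) (from_model (quad_act w c z)) -
          tree_ops.hat b (from_model_tree u) (tree_ops.hat c (from_model_tree w) (from_model z))
          \<in> ideal quad_relations (size1 u + (size1 w + n))"
        by (intro ideal_hat_cong ideal_refl Node.IH(2) Node.prems homogeneous_from_model_tree
            homogeneous_from_model homogeneous_quad_act)
      then show "tree_ops.hat b (from_model_tree u) (from_model (quad_act w c z)) -
          tree_ops.hat b (from_model_tree u) (tree_ops.hat c (from_model_tree w) (from_model z))
          \<in> ideal quad_relations ?N"
        by (simp add: add.assoc)
    qed
    let ?S = "\<Sum>b\<in>UNIV. \<Sum>c\<in>UNIV. quad_coeff q p b c \<cdot>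
          tree_ops.hat b (from_model_tree u) (tree_ops.hat c (from_model_tree w) (from_model z)) ::
          (dend_op \<times> dend_op) tree \<Rightarrow>\<^sub>0 'k"
    have "from_model (quad_act \<langle>u, q, w\<rangle> p z) - ?S =
        (\<Sum>b\<in>UNIV. \<Sum>c\<in>UNIV. quad_coeff q p b c \<cdot> (from_model (quad_act u b (quad_act w c z)) -
          tree_ops.hat b (from_model_tree u) (tree_ops.hat c (from_model_tree w) (from_model z))))"
      using True by (simp add: linear_pm_sum[OF linear_from_model] linear_pm_scale[OF linear_from_model]
          pm.scale_right_diff_distrib sum_subtractf)
    also have "\<dots> \<in> ideal quad_relations ?N"
      by (intro ideal_sum ideal_scale step)
    finally have "from_model (quad_act \<langle>u, q, w\<rangle> p z) - ?S \<in> ideal quad_relations ?N" .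
    moreover have "?S - tree_ops.hat p (tree_ops.hat q (from_model_tree u) (from_model_tree w)) (from_model z)
        \<in> ideal quad_relations ?N"
      by (rule ideal_sym, (rule ideal_quad_rule[OF True];
          intro homogeneous_from_model_tree homogeneous_from_model Node.prems))
    ultimately have "from_model (quad_act \<langle>u, q, w\<rangle> p z) -
        tree_ops.hat p (tree_ops.hat q (from_model_tree u) (from_model_tree w)) (from_model z) \<in> ideal quad_relations ?N"
      by (rule ideal_trans)
    then show ?thesis by simp
  qed
qed

lemma from_model_mul:
  assumes "homogeneous k x" "homogeneous n z"
  shows "from_model (quad.mul p x z) - tree_ops.hat p (from_model x) (from_model z) \<in> ideal quad_relations (k + n)"
proof -
  have "from_model (quad.mul p x z) - tree_ops.hat p (from_model x) (from_model z) =
      lin_map (\<lambda>t. from_model (quad_act t p z) - tree_ops.hat p (from_model_tree t) (from_model z)) x"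
    by (simp add: quad.mul_def from_model_def linear_pm_lin_map[OF linear_lin_map]
        linear_pm_lin_map[OF tree_ops.linear_hat(1)] lin_map_diff_family)
  also have "\<dots> \<in> ideal quad_relations (k + n)"
  proof (rule ideal_lin_map)
    fix t assume "t \<in> Poly_Mapping.keys x"
    then have "size1 t = k" using assms(1) by (simp add: homogeneous_def)
    then show "from_model (quad_act t p z) - tree_ops.hat p (from_model_tree t) (from_model z)
        \<in> ideal quad_relations (k + n)"
      using from_model_quad_act[OF assms(2), of t p] by simp
  qed
  finally show ?thesis .
qed

definition model_value :: "(dend_op \<times> dend_op) tree \<Rightarrow> ((half_op \<times> half_op) tree \<Rightarrow>\<^sub>0 'k::field)" where
  "model_value t = evaluate model_op t (\<lambda>_. basis_vec \<langle>\<rangle>)"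

lemma model_value_Node: "model_value \<langle>l, a, r\<rangle> = model_op a (model_value l) (model_value r)"
  by (simp add: model_value_def)

lemma keys_model_op:
  assumes "\<forall>t\<in>Poly_Mapping.keys x. reduced quad_lead t \<and> size1 t = k"
    and "\<forall>t\<in>Poly_Mapping.keys z. reduced quad_lead t \<and> size1 t = n"
  shows "\<forall>t\<in>Poly_Mapping.keys (model_op a x z). reduced quad_lead t \<and> size1 t = k + n"
proof -
  note mul = quad.keys_mul[OF assms]
  have add: "\<forall>t\<in>Poly_Mapping.keys (p + q). P t" if "\<forall>t\<in>Poly_Mapping.keys p. P t" "\<forall>t\<in>Poly_Mapping.keys q. P t"
    for P and p q :: "(half_op \<times> half_op) tree \<Rightarrow>\<^sub>0 'a"
    using that subsetD[OF Poly_Mapping.keys_add[of p q]] by fastforce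
  have diff: "\<forall>t\<in>Poly_Mapping.keys (p - q). P t" if "\<forall>t\<in>Poly_Mapping.keys p. P t" "\<forall>t\<in>Poly_Mapping.keys q. P t"
    for P and p q :: "(half_op \<times> half_op) tree \<Rightarrow>\<^sub>0 'a"
    using that subsetD[OF Poly_Mapping.keys_diff[of p q]] by fastforce
  show ?thesis
    by (cases a rule: dend_op_pair_cases; simp only: model_op.simps) (intro add diff mul)+
qed

lemma keys_model_value:
  "\<forall>s\<in>Poly_Mapping.keys (model_value t). reduced quad_lead s \<and> size1 s = size1 t"
proof (induction t)
  case Leaf
  show ?case by (simp add: model_value_def)
next
  case (Node l a r)
  then show ?case using keys_model_op[OF Node.IH] by (simp add: model_value_Node)
qed

lemma homogeneous_model_value: "homogeneous (size1 t) (model_value t)"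
  using keys_model_value by (auto simp: homogeneous_def)

lemma from_model_model_op:
  assumes "homogeneous k x" "homogeneous n z"
  shows "from_model (model_op a x z) - node a (from_model x) (from_model z) \<in> ideal quad_relations (k + n)"
proof -
  note mul = from_model_mul[OF assms]
  note lin = linear_pm_add[OF linear_from_model] linear_pm_diff[OF linear_from_model]
  have add: "(p + q) - (p' + q') \<in> ideal quad_relations (k + n)"
    if "p - p' \<in> ideal quad_relations (k + n)" "q - q' \<in> ideal quad_relations (k + n)"
    for p q p' q' :: "(dend_op \<times> dend_op) tree \<Rightarrow>\<^sub>0 'a"
    using ideal_add[OF that] by (simp add: algebra_simps)
  have diff: "(p - q) - (p' - q') \<in> ideal quad_relations (k + n)"
    if "p - p' \<in> ideal quad_relations (k + n)" "q - q' \<in> ideal quad_relations (k + n)"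
    for p q p' q' :: "(dend_op \<times> dend_op) tree \<Rightarrow>\<^sub>0 'a"
    using ideal_diff[OF that] by (simp add: algebra_simps)
  show ?thesis
    by (cases a rule: dend_op_pair_cases; simp only: model_op.simps lin tree_ops.op_eq_hat)
      (intro add diff mul)+
qed

text \<open>Since \<open>from_model\<close> respects the operations modulo the ideal, a tree is congruent to the expansion
  of its value in the algebra of trees, which is a combination of reduced trees by
  \<open>keys_model_value\<close>.\<close>

lemma basis_eq_from_model_value:
  "(basis_vec t :: _ \<Rightarrow>\<^sub>0 'k::field) - from_model (model_value t) \<in> ideal quad_relations (size1 t)"
proof (induction t)
  case Leaf
  show ?case by (simp add: model_value_def from_model_def ideal_zero)
next
  case (Node l a r)
  have "node a (basis_vec l) (basis_vec r :: _ \<Rightarrow>\<^sub>0 'k) - node a (from_model (model_value l)) (from_model (model_value r))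
      \<in> ideal quad_relations (size1 l + size1 r)"
    by (intro ideal_node_cong Node.IH homogeneous_from_model homogeneous_model_value) simp
  moreover have "node a (from_model (model_value l)) (from_model (model_value r)) -
      (from_model (model_op a (model_value l) (model_value r)) :: _ \<Rightarrow>\<^sub>0 'k) \<in> ideal quad_relations (size1 l + size1 r)"
    by (rule ideal_sym, rule from_model_model_op) (rule homogeneous_model_value)+
  ultimately have "node a (basis_vec l) (basis_vec r :: _ \<Rightarrow>\<^sub>0 'k) -
      from_model (model_op a (model_value l) (model_value r)) \<in> ideal quad_relations (size1 l + size1 r)"
    by (rule ideal_trans)
  then show ?case by (simp add: model_value_Node)
qed

section \<open>The dimension of the components\<close>

lemma free_vs_simps:
  "carrier (free_vs X) = {p. Poly_Mapping.keys p \<subseteq> X}" "\<zero>\<^bsub>free_vs X\<^esub> = 0"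
  "x \<oplus>\<^bsub>free_vs X\<^esub> y = x + y" "c \<odot>\<^bsub>free_vs X\<^esub> x = c \<cdot> x"
  by (simp_all add: free_vs_def)

lemma finsum_free_vs:
  assumes "finite A" "f \<in> A \<rightarrow> carrier (free_vs X :: ('k::field, 'x \<Rightarrow>\<^sub>0 'k) module)"
  shows "finsum (free_vs X :: ('k, 'x \<Rightarrow>\<^sub>0 'k) module) f A = sum f A"
proof -
  interpret vectorspace class_ring "free_vs X :: ('k, 'x \<Rightarrow>\<^sub>0 'k) module" by (rule vectorspace_free_vs)
  show ?thesis
    using assms
  proof (induction A)
    case empty
    show ?case by (simp only: M.finsum_empty free_vs_simps sum.empty)
  next
    case (insert x A)
    then have "finsum (free_vs X) f (insert x A) = f x \<oplus>\<^bsub>free_vs X\<^esub> finsum (free_vs X) f A"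
      by (intro M.finsum_insert) auto
    then show ?case using insert by (simp add: free_vs_simps)
  qed
qed

lemma dim_free_vs:
  fixes X :: "'x set"
  assumes "finite X"
  shows "vectorspace.fin_dim class_ring (free_vs X :: ('k::field, 'x \<Rightarrow>\<^sub>0 'k) module) \<and>
    vectorspace.dim class_ring (free_vs X :: ('k, 'x \<Rightarrow>\<^sub>0 'k) module) = card X"
proof -
  let ?V = "free_vs X :: ('k, 'x \<Rightarrow>\<^sub>0 'k) module"
  interpret vectorspace class_ring ?V by (rule vectorspace_free_vs)
  define B where "B = (basis_vec ` X :: ('x \<Rightarrow>\<^sub>0 'k) set)"
  have inj: "inj_on (basis_vec :: 'x \<Rightarrow> 'x \<Rightarrow>\<^sub>0 'k) Y" for Y
    by (rule inj_onI) (metis keys_single one_neq_zero singleton_iff)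
  have B: "finite B" "B \<subseteq> carrier ?V"
    using assms by (auto simp: B_def free_vs_simps)
  have lincomb_eq: "lincomb a (basis_vec ` Y) = (\<Sum>x\<in>Y. a (basis_vec x) \<cdot> basis_vec x)"
    if "Y \<subseteq> X" for a :: "('x \<Rightarrow>\<^sub>0 'k) \<Rightarrow> 'k" and Y
  proof -
    have fin: "finite (basis_vec ` Y :: ('x \<Rightarrow>\<^sub>0 'k) set)"
      using that assms finite_subset by blast
    have "(\<lambda>v. a v \<odot>\<^bsub>?V\<^esub> v) \<in> basis_vec ` Y \<rightarrow> carrier ?V"
      using that by (auto simp: free_vs_simps in_keys_iff lookup_map_mult lookup_single when_def split: if_splits)
    then have "lincomb a (basis_vec ` Y) = (\<Sum>v\<in>basis_vec ` Y. a v \<cdot> v)"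
      unfolding lincomb_def by (simp add: finsum_free_vs[OF fin]) (simp add: free_vs_simps)
    then show ?thesis by (simp only: sum.reindex[OF inj] o_def)
  qed
  have lookup_lincomb: "Poly_Mapping.lookup (lincomb a (basis_vec ` Y)) x = a (basis_vec x)"
    if "Y \<subseteq> X" "x \<in> Y" for a Y x
    using that finite_subset[OF _ assms, of Y]
    by (simp add: lincomb_eq lookup_sum lookup_map_mult lookup_single when_def if_distrib cong: if_cong)
  have "lin_indpt B"
  proof
    assume "lin_dep B"
    then obtain A a v where A: "A \<subseteq> B" "lincomb a A = \<zero>\<^bsub>?V\<^esub>" "v \<in> A" "a v \<noteq> \<zero>\<^bsub>class_ring\<^esub>"
      unfolding lin_dep_def by blast
    then obtain Y where Y: "Y \<subseteq> X" "A = basis_vec ` Y" unfolding B_def by (auto elim: subset_imageE)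
    then obtain x where x: "x \<in> Y" "v = basis_vec x" using A by auto
    then show False using lookup_lincomb[OF Y(1) x(1), of a] A Y by (simp add: free_vs_simps)
  qed
  moreover have "span B = carrier ?V"
  proof
    show "span B \<subseteq> carrier ?V" using B by (intro span_is_subset2)
    show "carrier ?V \<subseteq> span B"
    proof
      fix p assume p: "p \<in> carrier ?V"
      define a where "a v = (\<Sum>x\<in>X. Poly_Mapping.lookup p x * Poly_Mapping.lookup v x)" for v
      have a: "a (basis_vec x) = Poly_Mapping.lookup p x" if "x \<in> X" for x
        using that assms by (simp add: a_def lookup_single when_def if_distrib cong: if_cong)
      have "p = lincomb a B"
      proof (rule poly_mapping_eqI)
        fix x
        show "Poly_Mapping.lookup p x = Poly_Mapping.lookup (lincomb a B) x"
        proof (cases "x \<in> X")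
          case True
          then show ?thesis unfolding B_def by (simp add: lookup_lincomb a)
        next
          case False
          have "lincomb a B \<in> carrier ?V" using B by (intro lincomb_closed) auto
          then have "x \<notin> Poly_Mapping.keys (lincomb a B)" "x \<notin> Poly_Mapping.keys p"
            using False p by (auto simp: free_vs_simps)
          then show ?thesis by (simp add: in_keys_iff)
        qed
      qed
      then show "p \<in> span B" unfolding span_def using B by auto
    qed
  qed
  ultimately have "basis B" using B by (simp add: basis_def)
  then have "dim = card B" using B by (intro dim_basis)
  moreover have "fin_dim" unfolding fin_dim_def using B \<open>span B = carrier ?V\<close> by blast
  ultimately show ?thesis by (simp add: B_def card_image[OF inj])
qed

lemma component_free_operad:
  "component free_operad n = free_vs {t. size1 t = n}"
  by (simp add: free_operad_def)

lemma coset_free_operad: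
  "J +>\<^bsub>component free_operad n\<^esub> x = {h + x | h. h \<in> J}"
  by (auto simp: component_free_operad a_r_coset_def r_coset_def free_vs_simps)

lemma coset_ideal_eq_iff:
  "ideal \<Lambda> n +>\<^bsub>component free_operad n\<^esub> x = ideal \<Lambda> n +>\<^bsub>component free_operad n\<^esub> y \<longleftrightarrow> x - y \<in> ideal \<Lambda> n"
proof
  assume "ideal \<Lambda> n +>\<^bsub>component free_operad n\<^esub> x = ideal \<Lambda> n +>\<^bsub>component free_operad n\<^esub> y"
  moreover have "x \<in> ideal \<Lambda> n +>\<^bsub>component free_operad n\<^esub> x"
    unfolding coset_free_operad using ideal_zero[of \<Lambda> n] by (auto intro!: exI[of _ 0])
  ultimately obtain h where "h \<in> ideal \<Lambda> n" "x = h + y" unfolding coset_free_operad by auto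
  then show "x - y \<in> ideal \<Lambda> n" by simp
next
  assume xy: "x - y \<in> ideal \<Lambda> n"
  have "{h + x | h. h \<in> ideal \<Lambda> n} \<subseteq> {h + y | h. h \<in> ideal \<Lambda> n}" if "x - y \<in> ideal \<Lambda> n" for x y
  proof safe
    fix h assume "h \<in> ideal \<Lambda> n"
    then have "h + (x - y) \<in> ideal \<Lambda> n" using that by (rule ideal_add)
    then show "\<exists>h'. h + x = h' + y \<and> h' \<in> ideal \<Lambda> n"
      by (intro exI[of _ "h + (x - y)"]) simp
  qed
  from this[OF xy] this[OF ideal_sym[OF xy]]
  show "ideal \<Lambda> n +>\<^bsub>component free_operad n\<^esub> x = ideal \<Lambda> n +>\<^bsub>component free_operad n\<^esub> y"
    unfolding coset_free_operad by (rule equalityI)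
qed

lemma quadratic_operad_component_simps:
  fixes \<Lambda> :: "('b, 'k::field) relation set"
  defines "coset \<equiv> \<lambda>n x. ideal \<Lambda> n +>\<^bsub>component free_operad n\<^esub> x"
  shows "carrier (component (quadratic_operad \<Lambda>) n) = coset n ` {x. homogeneous n x}"
    and "coset n x \<oplus>\<^bsub>component (quadratic_operad \<Lambda>) n\<^esub> coset n y = coset n (x + y)"
    and "c \<odot>\<^bsub>component (quadratic_operad \<Lambda>) n\<^esub> coset n x = coset n (c \<cdot> x)"
proof -
  have Q: "component (quadratic_operad \<Lambda>) n = quotient_module (component free_operad n) (ideal \<Lambda> n)"
    by (simp add: quadratic_operad_def quotient_operad_def)
  show "carrier (component (quadratic_operad \<Lambda>) n) = coset n ` {x. homogeneous n x}"
    unfolding Q quotient_module_def coset_def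
    by (auto simp: A_RCOSETS_def' a_r_coset_def carrier_free_operad)
  have "(\<Union>u\<in>coset n x. \<Union>v\<in>coset n y. {u + v}) = coset n (x + y)"
  proof (intro equalityI subsetI)
    fix w assume "w \<in> (\<Union>u\<in>coset n x. \<Union>v\<in>coset n y. {u + v})"
    then obtain h h' where "h \<in> ideal \<Lambda> n" "h' \<in> ideal \<Lambda> n" "w = (h + x) + (h' + y)"
      unfolding coset_def coset_free_operad by auto
    then have "h + h' \<in> ideal \<Lambda> n" "w = (h + h') + (x + y)"
      by (simp_all add: ideal_add ac_simps)
    then show "w \<in> coset n (x + y)" unfolding coset_def coset_free_operad by auto
  next
    fix w assume "w \<in> coset n (x + y)"
    then obtain h where "h \<in> ideal \<Lambda> n" "w = (h + x) + y"
      unfolding coset_def coset_free_operad by (auto simp: add.assoc)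
    moreover have "y \<in> coset n y"
      unfolding coset_def coset_free_operad using ideal_zero[of \<Lambda> n] by (auto intro!: exI[of _ 0])
    moreover have "h + x \<in> coset n x"
      unfolding coset_def coset_free_operad using \<open>h \<in> ideal \<Lambda> n\<close> by auto
    ultimately show "w \<in> (\<Union>u\<in>coset n x. \<Union>v\<in>coset n y. {u + v})" by auto
  qed
  then show "coset n x \<oplus>\<^bsub>component (quadratic_operad \<Lambda>) n\<^esub> coset n y = coset n (x + y)"
    unfolding Q quotient_module_def by (simp add: set_add_defs component_free_operad free_vs_simps coset_def)
  have step: "coset n (c \<cdot> z) = coset n (c \<cdot> x)" if "z \<in> coset n x" for z
  proof -
    obtain h where "h \<in> ideal \<Lambda> n" "z = h + x"
      using \<open>z \<in> coset n x\<close> unfolding coset_def coset_free_operad by auto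
    then have "c \<cdot> z - c \<cdot> x \<in> ideal \<Lambda> n"
      using ideal_scale by (simp flip: pm.scale_right_diff_distrib)
    then show ?thesis unfolding coset_def coset_ideal_eq_iff .
  qed
  have "x \<in> coset n x"
    unfolding coset_def coset_free_operad using ideal_zero[of \<Lambda> n] by (auto intro!: exI[of _ 0])
  then have "(\<Union>z\<in>coset n x. coset n (c \<cdot> z)) = coset n (c \<cdot> x)"
    by (rule UN_constant_eq) (simp add: step)
  then show "c \<odot>\<^bsub>component (quadratic_operad \<Lambda>) n\<^esub> coset n x = coset n (c \<cdot> x)"
    unfolding Q quotient_module_def by (simp add: component_free_operad free_vs_simps coset_def)
qed

text \<open>The map that turns out to be an isomorphism from the space of reduced trees with \<open>n\<close> leaves to
  \<open>Quad(n)\<close>: it is injective since \<open>to_model\<close> is defined modulo the ideal and inverts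
  \<open>from_model\<close> on reduced trees, and surjective by rewriting.\<close>

definition reduced_class :: "nat \<Rightarrow> ((half_op \<times> half_op) tree \<Rightarrow>\<^sub>0 'k::field) \<Rightarrow>
    ((dend_op \<times> dend_op) tree \<Rightarrow>\<^sub>0 'k) set" where
  "reduced_class n p = ideal quad_relations n +>\<^bsub>component free_operad n\<^esub> from_model p"

abbreviation reduced_trees :: "nat \<Rightarrow> (half_op \<times> half_op) tree set" where
  "reduced_trees n \<equiv> {t. size1 t = n \<and> reduced quad_lead t}"

lemma to_model_from_model:
  assumes "p \<in> carrier (free_vs (reduced_trees n) :: ('k::field, _) module)"
  shows "to_model (from_model p) = p"
proof (rule linear_pm_eqI[where p = p and g = "\<lambda>p. p"])
  show "linear_pm (\<lambda>p. to_model (from_model p) :: _ \<Rightarrow>\<^sub>0 'k)"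
    by (rule linear_pm_comp[OF linear_to_model linear_from_model])
  fix t assume "t \<in> Poly_Mapping.keys p"
  then have "reduced quad_lead t" using assms by (auto simp: free_vs_simps)
  then show "to_model (from_model (basis_vec t)) = (basis_vec t :: _ \<Rightarrow>\<^sub>0 'k)"
    by (simp add: from_model_def to_model_from_model_tree)
qed (rule linear_pm_ident)

lemma reduced_class_linear_map:
  "linear_map class_ring (free_vs (reduced_trees n)) (component (Quad :: ('k::field, _) ns_operad) n)
    (reduced_class n)"
proof -
  have V: "vectorspace class_ring (free_vs (reduced_trees n) :: ('k, _) module)"
    by (rule vectorspace_free_vs)
  have W: "vectorspace class_ring (component (Quad :: ('k, _) ns_operad) n)"
    unfolding Quad_def by (rule vectorspace_quadratic_operad)
  have "homogeneous n p" if "p \<in> carrier (free_vs (reduced_trees n) :: ('k, _) module)" for p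
    using that by (auto simp: free_vs_simps homogeneous_def)
  then have "reduced_class n \<in> LinearCombinations.module_hom class_ring (free_vs (reduced_trees n))
      (component (Quad :: ('k, _) ns_operad) n)"
    unfolding LinearCombinations.module_hom_def reduced_class_def Quad_def
    by (auto simp: quadratic_operad_component_simps free_vs_simps linear_pm_add[OF linear_from_model]
        linear_pm_scale[OF linear_from_model] homogeneous_from_model)
  then show ?thesis
    using V W by (intro linear_map.intro mod_hom.intro mod_hom_axioms.intro) (auto intro: vectorspace.axioms)
qed

lemma inj_reduced_class:
  "inj_on (reduced_class n) (carrier (free_vs (reduced_trees n) :: ('k::field, _) module))"
proof (rule inj_onI)
  fix p q :: "(half_op \<times> half_op) tree \<Rightarrow>\<^sub>0 'k"
  assume pq: "p \<in> carrier (free_vs (reduced_trees n))" "q \<in> carrier (free_vs (reduced_trees n))"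
    and "reduced_class n p = reduced_class n q"
  then have "to_model (from_model p - from_model q) = 0"
    unfolding reduced_class_def coset_ideal_eq_iff by (intro to_model_ideal)
  then show "p = q"
    using pq by (simp add: linear_pm_diff[OF linear_to_model] to_model_from_model)
qed

lemma surj_reduced_class:
  "reduced_class n ` carrier (free_vs (reduced_trees n)) = carrier (component (Quad :: ('k::field, _) ns_operad) n)"
proof
  show "reduced_class n ` carrier (free_vs (reduced_trees n)) \<subseteq> carrier (component (Quad :: ('k, _) ns_operad) n)"
    using linear_map.T_im[OF reduced_class_linear_map] by blast
  show "carrier (component (Quad :: ('k, _) ns_operad) n) \<subseteq> reduced_class n ` carrier (free_vs (reduced_trees n))"
  proof
    fix A :: "((dend_op \<times> dend_op) tree \<Rightarrow>\<^sub>0 'k) set"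
    assume "A \<in> carrier (component Quad n)"
    then obtain x where x: "homogeneous n x" and A: "A = ideal quad_relations n +>\<^bsub>component free_operad n\<^esub> x"
      unfolding Quad_def quadratic_operad_component_simps(1) by auto
    define p where "p = lin_map model_value x"
    have p: "p \<in> carrier (free_vs (reduced_trees n))"
      using x keys_lin_map[of model_value x] keys_model_value
      by (fastforce simp: p_def free_vs_simps homogeneous_def)
    have "x - from_model p = lin_map (\<lambda>t. basis_vec t - from_model (model_value t)) x"
      unfolding lin_map_diff_family p_def linear_pm_lin_map[OF linear_from_model]
      using pm_eq_sum_keys[of x] by (simp add: lin_map_def)
    also have "\<dots> \<in> ideal quad_relations n"
    proof (rule ideal_lin_map)
      fix t assume "t \<in> Poly_Mapping.keys x"
      then have "size1 t = n" using x by (simp add: homogeneous_def)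
      then show "basis_vec t - from_model (model_value t) \<in> ideal quad_relations n"
        using basis_eq_from_model_value[of t] by simp
    qed
    finally have "A = reduced_class n p" unfolding A reduced_class_def coset_ideal_eq_iff .
    then show "A \<in> reduced_class n ` carrier (free_vs (reduced_trees n))" using p by blast
  qed
qed

theorem dim_Quad:
  "vectorspace.fin_dim class_ring (component (Quad :: ('k::field, _) ns_operad) n) \<and>
    vectorspace.dim class_ring (component (Quad :: ('k, _) ns_operad) n) = card (reduced_trees n)"
proof -
  interpret linear_map class_ring "free_vs (reduced_trees n) :: ('k, _) module"
    "component (Quad :: ('k, _) ns_operad) n" "reduced_class n"
    by (rule reduced_class_linear_map)
  have "finite (reduced_trees n)"
    by (rule finite_subset[OF _ finite_trees_of_size[of n]]) auto
  note dim = dim_free_vs[OF this, where ?'k = 'k]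
  show ?thesis
    using dim_eq[OF _ inj_reduced_class surj_reduced_class] surj_fin_dim[OF _ surj_reduced_class] dim by simp
qed

theorem corollary4p7:
  fixes n :: nat
  assumes "n \<ge> 1"
  shows "vectorspace.fin_dim class_ring
      (component (Quad :: ('k::{alg_closed_field, field_char_0}, _) ns_operad) n) \<and>
    real (vectorspace.dim class_ring
      (component (Quad :: ('k::{alg_closed_field, field_char_0}, _) ns_operad) n)) =
    1 / real n * (\<Sum>j = n..2 * n - 1.
      real (((3 * n) choose (n + 1 + j)) * ((j - 1) choose (j - n))))"
  using dim_Quad[of n, where ?'k = 'k] card_reduced_quad[of n] assms by (simp add: field_simps)

end
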